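(* Let $n\in\mathbb N$ and let $S$ be a commutative inverse semigroup with set of idempotents $E$. Then $\ell^1(S)$ is $n$-weakly module amenable as an $\ell^1(E)$-module with the actions $\delta_e\cdot\delta_s=\delta_s\cdot\delta_e=\delta_s*\delta_e=\delta_{se}$ ($s\in S$, $e\in E$).
   Context: A discrete semigroup $S$ is an inverse semigroup if for each $s\in S$ there is a unique $s^*\in S$ with $ss^*s=s$ and $s^*ss^*=s^*$. An idempotent is an $e\in S$ with $e=e^*=e^2$; the set $E$ of idempotents is a commutative subsemigroup, and $\ell^1(E)$ is a subalgebra of the semigroup (convolution) algebra $\ell^1(S)$. Let $\mathfrak A$ be a Banach algebra and $\mathcal A$ a Banach algebra which is a Banach $\mathfrak A$-bimodule with $\alpha\cdot(ab)=(\alpha\cdot a)b$, $(ab)\cdot\alpha=a(b\cdot\alpha)$. A Banach $\mathcal A$-$\mathfrak A$-module is a Banach $\mathcal A$-bimodule and Banach $\mathfrak A$-bimodule $X$ with $\alpha\cdot(a\cdot x)=(\alpha\cdot a)\cdot x$, $(\alpha\cdot x)\cdot a=\alpha\cdot(x\cdot a)$, $x\cdot(a\cdot\alpha)=(x\cdot a)\cdot\alpha$, $(a\cdot x)\cdot\alpha=a\cdot(x\cdot\alpha)$, $a\cdot(\alpha\cdot x)=(a\cdot\alpha)\cdot x$, $x\cdot(\alpha\cdot a)=(x\cdot\alpha)\cdot a$; it is commutative if $\alpha\cdot x=x\cdot\alpha$. $X^{(n)}$ is the $n$-th dual with iterated dual actions ($\langle f\cdot a,x\rangle=\langle f,a\cdot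 x\rangle$, $\langle a\cdot f,x\rangle=\langle f,x\cdot a\rangle$, likewise for $\mathfrak A$). A module derivation $D:\mathcal A\to X$ is an additive map commuting with left and right $\mathfrak A$-actions (not necessarily $\mathbb C$-linear), bounded in the sense $\|D(a)\|\le M\|a\|$ for some $M>0$, with $D(ab)=D(a)\cdot b+a\cdot D(b)$; it is inner if $D(a)=a\cdot x-x\cdot a$ for some $x\in X$. $\mathcal A$ is $n$-weakly module amenable (as an $\mathfrak A$-module) if $(\mathcal A/J)^{(n)}$ is a commutative $\mathcal A$-$\mathfrak A$-module and each module derivation $\mathcal A\to(\mathcal A/J)^{(n)}$ is inner, where $J$ is the closed ideal of $\mathcal A$ generated by the elements $(a\cdot\alpha)b-a(\alpha\cdot b)$ ($a,b\in\mathcal A,\alpha\in\mathfrak A$). (In the present case $J=\{0\}$.) *)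

theory Defs
  imports "HOL-Analysis.Analysis" "HOL-Algebra.Module" "HOL-Algebra.AbelCoset"
begin

section \<open>Banach spaces, algebras and modules on explicit carriers\<close>

text \<open>
  Successive duals of a space have ever larger cardinality, and no single type accommodates all of
  them. Complex normed spaces are therefore records with an explicit carrier, on top of the modules
  of HOL-Algebra over the field of complex numbers. The fields \<open>mult\<close> and \<open>one\<close> inherited from
  \<open>module\<close> carry no meaning for spaces without a product, and \<open>one\<close> is never used, because Banach
  algebras need not be unital.
\<close>

definition complex_scalars :: "complex ring"
  where "complex_scalars = \<lparr>carrier = UNIV, mult = (*), one = 1, zero = 0, add = (+)\<rparr>"

record 'x cnspace = "(complex, 'x) module" +
  vnorm :: "'x \<Rightarrow> real"

locale cnormed_space = module complex_scalars X for X :: "('x, 'z) cnspace_scheme" (structure) +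
  assumes vnorm_eq_0: "x \<in> carrier X \<Longrightarrow> vnorm X x = 0 \<longleftrightarrow> x = \<zero>"
    and vnorm_triangle: "\<lbrakk>x \<in> carrier X; y \<in> carrier X\<rbrakk> \<Longrightarrow> vnorm X (x \<oplus> y) \<le> vnorm X x + vnorm X y"
    and vnorm_smult: "x \<in> carrier X \<Longrightarrow> vnorm X (c \<odot> x) = cmod c * vnorm X x"

locale cbanach_space = cnormed_space +
  assumes complete:
    "\<lbrakk>\<And>i. \<sigma> i \<in> carrier X;
      \<forall>\<epsilon>>0. \<exists>N. \<forall>i\<ge>N. \<forall>j\<ge>N. vnorm X (\<sigma> i \<ominus> \<sigma> j) < \<epsilon>\<rbrakk>
     \<Longrightarrow> \<exists>x\<in>carrier X. (\<lambda>i::nat. vnorm X (\<sigma> i \<ominus> x)) \<longlonglongrightarrow> 0"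

locale cbanach_algebra = cbanach_space A for A :: "('a, 'z) cnspace_scheme" (structure) +
  assumes mult_closed: "\<lbrakk>a \<in> carrier A; b \<in> carrier A\<rbrakk> \<Longrightarrow> a \<otimes> b \<in> carrier A"
    and mult_assoc: "\<lbrakk>a \<in> carrier A; b \<in> carrier A; c \<in> carrier A\<rbrakk> \<Longrightarrow> (a \<otimes> b) \<otimes> c = a \<otimes> (b \<otimes> c)"
    and mult_add_left: "\<lbrakk>a \<in> carrier A; b \<in> carrier A; c \<in> carrier A\<rbrakk> \<Longrightarrow> (a \<oplus> b) \<otimes> c = a \<otimes> c \<oplus> b \<otimes> c"
    and mult_add_right: "\<lbrakk>a \<in> carrier A; b \<in> carrier A; c \<in> carrier A\<rbrakk> \<Longrightarrow> a \<otimes> (b \<oplus> c) = a \<otimes> b \<oplus> a \<otimes> c"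
    and mult_smult_left: "\<lbrakk>a \<in> carrier A; b \<in> carrier A\<rbrakk> \<Longrightarrow> (z \<odot> a) \<otimes> b = z \<odot> (a \<otimes> b)"
    and mult_smult_right: "\<lbrakk>a \<in> carrier A; b \<in> carrier A\<rbrakk> \<Longrightarrow> a \<otimes> (z \<odot> b) = z \<odot> (a \<otimes> b)"
    and vnorm_mult: "\<lbrakk>a \<in> carrier A; b \<in> carrier A\<rbrakk> \<Longrightarrow> vnorm A (a \<otimes> b) \<le> vnorm A a * vnorm A b"

text \<open>\<open>l b x\<close> is \<open>b \<cdot> x\<close> and \<open>r x b\<close> is \<open>x \<cdot> b\<close>.\<close>

locale banach_bimodule =
  B: cbanach_algebra B + X: cbanach_space X
  for B :: "('b, 'y) cnspace_scheme" and X :: "('x, 'z) cnspace_scheme"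
    and l :: "'b \<Rightarrow> 'x \<Rightarrow> 'x" and r :: "'x \<Rightarrow> 'b \<Rightarrow> 'x" +
  assumes l_closed: "\<lbrakk>b \<in> carrier B; x \<in> carrier X\<rbrakk> \<Longrightarrow> l b x \<in> carrier X"
    and r_closed: "\<lbrakk>b \<in> carrier B; x \<in> carrier X\<rbrakk> \<Longrightarrow> r x b \<in> carrier X"
    and l_add1: "\<lbrakk>b \<in> carrier B; c \<in> carrier B; x \<in> carrier X\<rbrakk> \<Longrightarrow> l (b \<oplus>\<^bsub>B\<^esub> c) x = l b x \<oplus>\<^bsub>X\<^esub> l c x"
    and l_add2: "\<lbrakk>b \<in> carrier B; x \<in> carrier X; y \<in> carrier X\<rbrakk> \<Longrightarrow> l b (x \<oplus>\<^bsub>X\<^esub> y) = l b x \<oplus>\<^bsub>X\<^esub> l b y"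
    and l_smult1: "\<lbrakk>b \<in> carrier B; x \<in> carrier X\<rbrakk> \<Longrightarrow> l (z \<odot>\<^bsub>B\<^esub> b) x = z \<odot>\<^bsub>X\<^esub> l b x"
    and l_smult2: "\<lbrakk>b \<in> carrier B; x \<in> carrier X\<rbrakk> \<Longrightarrow> l b (z \<odot>\<^bsub>X\<^esub> x) = z \<odot>\<^bsub>X\<^esub> l b x"
    and r_add1: "\<lbrakk>b \<in> carrier B; c \<in> carrier B; x \<in> carrier X\<rbrakk> \<Longrightarrow> r x (b \<oplus>\<^bsub>B\<^esub> c) = r x b \<oplus>\<^bsub>X\<^esub> r x c"
    and r_add2: "\<lbrakk>b \<in> carrier B; x \<in> carrier X; y \<in> carrier X\<rbrakk> \<Longrightarrow> r (x \<oplus>\<^bsub>X\<^esub> y) b = r x b \<oplus>\<^bsub>X\<^esub> r y b"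
    and r_smult1: "\<lbrakk>b \<in> carrier B; x \<in> carrier X\<rbrakk> \<Longrightarrow> r x (z \<odot>\<^bsub>B\<^esub> b) = z \<odot>\<^bsub>X\<^esub> r x b"
    and r_smult2: "\<lbrakk>b \<in> carrier B; x \<in> carrier X\<rbrakk> \<Longrightarrow> r (z \<odot>\<^bsub>X\<^esub> x) b = z \<odot>\<^bsub>X\<^esub> r x b"
    and l_mult: "\<lbrakk>b \<in> carrier B; c \<in> carrier B; x \<in> carrier X\<rbrakk> \<Longrightarrow> l (b \<otimes>\<^bsub>B\<^esub> c) x = l b (l c x)"
    and r_mult: "\<lbrakk>b \<in> carrier B; c \<in> carrier B; x \<in> carrier X\<rbrakk> \<Longrightarrow> r x (b \<otimes>\<^bsub>B\<^esub> c) = r (r x b) c"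
    and l_r: "\<lbrakk>b \<in> carrier B; c \<in> carrier B; x \<in> carrier X\<rbrakk> \<Longrightarrow> r (l b x) c = l b (r x c)"
    and l_bounded: "\<exists>K. \<forall>b\<in>carrier B. \<forall>x\<in>carrier X. vnorm X (l b x) \<le> K * vnorm B b * vnorm X x"
    and r_bounded: "\<exists>K. \<forall>b\<in>carrier B. \<forall>x\<in>carrier X. vnorm X (r x b) \<le> K * vnorm B b * vnorm X x"

text \<open>
  Throughout, \<open>\<A>\<close> is the acting Banach algebra (with elements \<open>\<alpha>\<close>, \<open>\<beta>\<close>) and \<open>A\<close> the algebra on which
  it acts, by \<open>scl A \<alpha> a = \<alpha> \<cdot> a\<close> and \<open>scr A a \<alpha> = a \<cdot> \<alpha>\<close>.
\<close>

record ('c, 'a) module_alg = "'a cnspace" +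
  scl :: "'c \<Rightarrow> 'a \<Rightarrow> 'a"
  scr :: "'a \<Rightarrow> 'c \<Rightarrow> 'a"

locale banach_module_algebra =
  A: cbanach_algebra A + banach_bimodule \<A> A "scl A" "scr A"
  for \<A> :: "('c, 'y) cnspace_scheme" and A :: "('c, 'a, 'z) module_alg_scheme" (structure) +
  assumes scl_mult: "\<lbrakk>\<alpha> \<in> carrier \<A>; a \<in> carrier A; b \<in> carrier A\<rbrakk> \<Longrightarrow> scl A \<alpha> (a \<otimes> b) = scl A \<alpha> a \<otimes> b"
    and scr_mult: "\<lbrakk>\<alpha> \<in> carrier \<A>; a \<in> carrier A; b \<in> carrier A\<rbrakk> \<Longrightarrow> scr A (a \<otimes> b) \<alpha> = a \<otimes> scr A b \<alpha>"

text \<open>A space with a left and a right action of \<open>A\<close> and a left and a right action of \<open>\<A>\<close>.\<close>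

record ('c, 'a, 'x) two_module = "'x cnspace" +
  lact :: "'a \<Rightarrow> 'x \<Rightarrow> 'x"
  ract :: "'x \<Rightarrow> 'a \<Rightarrow> 'x"
  lsc :: "'c \<Rightarrow> 'x \<Rightarrow> 'x"
  rsc :: "'x \<Rightarrow> 'c \<Rightarrow> 'x"

locale banach_two_module =
  AX: banach_bimodule A X "lact X" "ract X" + CX: banach_bimodule \<A> X "lsc X" "rsc X"
  for \<A> :: "('c, 'y) cnspace_scheme" and A :: "('c, 'a, 'z) module_alg_scheme"
    and X :: "('c, 'a, 'x, 'w) two_module_scheme" +
  assumes lsc_lact: "\<lbrakk>\<alpha> \<in> carrier \<A>; a \<in> carrier A; x \<in> carrier X\<rbrakk> \<Longrightarrow> lsc X \<alpha> (lact X a x) = lact X (scl A \<alpha> a) x"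
    and lsc_ract: "\<lbrakk>\<alpha> \<in> carrier \<A>; a \<in> carrier A; x \<in> carrier X\<rbrakk> \<Longrightarrow> ract X (lsc X \<alpha> x) a = lsc X \<alpha> (ract X x a)"
    and ract_scr: "\<lbrakk>\<alpha> \<in> carrier \<A>; a \<in> carrier A; x \<in> carrier X\<rbrakk> \<Longrightarrow> ract X x (scr A a \<alpha>) = rsc X (ract X x a) \<alpha>"
    and lact_rsc: "\<lbrakk>\<alpha> \<in> carrier \<A>; a \<in> carrier A; x \<in> carrier X\<rbrakk> \<Longrightarrow> rsc X (lact X a x) \<alpha> = lact X a (rsc X x \<alpha>)"
    and lact_lsc: "\<lbrakk>\<alpha> \<in> carrier \<A>; a \<in> carrier A; x \<in> carrier X\<rbrakk> \<Longrightarrow> lact X a (lsc X \<alpha> x) = lact X (scr A a \<alpha>) x"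
    and ract_scl: "\<lbrakk>\<alpha> \<in> carrier \<A>; a \<in> carrier A; x \<in> carrier X\<rbrakk> \<Longrightarrow> ract X x (scl A \<alpha> a) = ract X (rsc X x \<alpha>) a"

locale commutative_banach_two_module = banach_two_module +
  assumes lsc_eq_rsc: "\<lbrakk>\<alpha> \<in> carrier \<A>; x \<in> carrier X\<rbrakk> \<Longrightarrow> lsc X \<alpha> x = rsc X x \<alpha>"


section \<open>The quotient by the ideal \<open>J\<close>\<close>

definition closed_ideal :: "('a, 'z) cnspace_scheme \<Rightarrow> 'a set \<Rightarrow> bool"
  where "closed_ideal A I \<longleftrightarrow>
    submodule I complex_scalars A \<and>
    (\<forall>a\<in>carrier A. \<forall>x\<in>I. a \<otimes>\<^bsub>A\<^esub> x \<in> I \<and> x \<otimes>\<^bsub>A\<^esub> a \<in> I) \<and>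
    (\<forall>\<sigma> x. (\<forall>i::nat. \<sigma> i \<in> I) \<and> x \<in> carrier A \<and> (\<lambda>i. vnorm A (\<sigma> i \<ominus>\<^bsub>A\<^esub> x)) \<longlonglongrightarrow> 0 \<longrightarrow> x \<in> I)"

definition module_ideal :: "('c, 'y) cnspace_scheme \<Rightarrow> ('c, 'a, 'z) module_alg_scheme \<Rightarrow> 'a set"
  where "module_ideal \<A> A =
    \<Inter>{I. closed_ideal A I \<and>
        (\<forall>a\<in>carrier A. \<forall>b\<in>carrier A. \<forall>\<alpha>\<in>carrier \<A>.
          (scr A a \<alpha> \<otimes>\<^bsub>A\<^esub> b) \<ominus>\<^bsub>A\<^esub> (a \<otimes>\<^bsub>A\<^esub> scl A \<alpha> b) \<in> I)}"

text \<open>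
  The elements of \<open>A / J\<close> are the cosets \<open>J + x\<close>. As for products in \<open>FactRing\<close>, an operation on a coset
  \<open>C\<close> is written as a union over the representatives of \<open>C\<close>; if \<open>J\<close> is an ideal and an \<open>\<A>\<close>-submodule,
  all members of that union coincide.
\<close>

definition quotient_module :: "('c, 'a, 'z) module_alg_scheme \<Rightarrow> 'a set \<Rightarrow> ('c, 'a, 'a set) two_module"
  where "quotient_module A J =
    \<lparr>carrier = a_rcosets\<^bsub>A\<^esub> J, mult = undefined, one = undefined,
     zero = J,
     add = (\<lambda>C D. C <+>\<^bsub>A\<^esub> D),
     smult = (\<lambda>z C. \<Union>x\<in>C. J +>\<^bsub>A\<^esub> (z \<odot>\<^bsub>A\<^esub> x)),
     vnorm = (\<lambda>C. Inf (vnorm A ` C)),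
     lact = (\<lambda>a C. \<Union>x\<in>C. J +>\<^bsub>A\<^esub> (a \<otimes>\<^bsub>A\<^esub> x)),
     ract = (\<lambda>C a. \<Union>x\<in>C. J +>\<^bsub>A\<^esub> (x \<otimes>\<^bsub>A\<^esub> a)),
     lsc = (\<lambda>\<alpha> C. \<Union>x\<in>C. J +>\<^bsub>A\<^esub> scl A \<alpha> x),
     rsc = (\<lambda>C \<alpha>. \<Union>x\<in>C. J +>\<^bsub>A\<^esub> scr A x \<alpha>)\<rparr>"


section \<open>Iterated duals\<close>

definition bounded_functional :: "('x, 'z) cnspace_scheme \<Rightarrow> ('x \<Rightarrow> complex) \<Rightarrow> bool"
  where "bounded_functional X f \<longleftrightarrow>
    (\<forall>x\<in>carrier X. \<forall>y\<in>carrier X. f (x \<oplus>\<^bsub>X\<^esub> y) = f x + f y) \<and>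
    (\<forall>z. \<forall>x\<in>carrier X. f (z \<odot>\<^bsub>X\<^esub> x) = z * f x) \<and>
    (\<exists>K. \<forall>x\<in>carrier X. cmod (f x) \<le> K * vnorm X x)"

definition dual :: "('c, 'a, 'x) two_module \<Rightarrow> ('c, 'a, 'x \<Rightarrow> complex) two_module"
  where "dual X =
    \<lparr>carrier = {f \<in> extensional (carrier X). bounded_functional X f},
     mult = undefined, one = undefined,
     zero = (\<lambda>x\<in>carrier X. 0),
     add = (\<lambda>f g. \<lambda>x\<in>carrier X. f x + g x),
     smult = (\<lambda>z f. \<lambda>x\<in>carrier X. z * f x),
     vnorm = (\<lambda>f. Sup {cmod (f x) | x. x \<in> carrier X \<and> vnorm X x \<le> 1}),
     lact = (\<lambda>a f. \<lambda>x\<in>carrier X. f (ract X x a)),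
     ract = (\<lambda>f a. \<lambda>x\<in>carrier X. f (lact X a x)),
     lsc = (\<lambda>\<alpha> f. \<lambda>x\<in>carrier X. f (rsc X x \<alpha>)),
     rsc = (\<lambda>f \<alpha>. \<lambda>x\<in>carrier X. f (lsc X \<alpha> x))\<rparr>"

definition isometric_iso ::
    "('c, 'y) cnspace_scheme \<Rightarrow> ('a, 'z) cnspace_scheme \<Rightarrow> ('x \<Rightarrow> 'v) \<Rightarrow>
     ('c, 'a, 'x) two_module \<Rightarrow> ('c, 'a, 'v) two_module \<Rightarrow> bool"
  where "isometric_iso \<A> A \<phi> X Y \<longleftrightarrow>
    bij_betw \<phi> (carrier X) (carrier Y) \<and>
    \<phi> \<zero>\<^bsub>X\<^esub> = \<zero>\<^bsub>Y\<^esub> \<and>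
    (\<forall>x\<in>carrier X.
      (\<forall>x'\<in>carrier X. \<phi> (x \<oplus>\<^bsub>X\<^esub> x') = \<phi> x \<oplus>\<^bsub>Y\<^esub> \<phi> x') \<and>
      (\<forall>z. \<phi> (z \<odot>\<^bsub>X\<^esub> x) = z \<odot>\<^bsub>Y\<^esub> \<phi> x) \<and>
      vnorm Y (\<phi> x) = vnorm X x \<and>
      (\<forall>a\<in>carrier A. \<phi> (lact X a x) = lact Y a (\<phi> x) \<and> \<phi> (ract X x a) = ract Y (\<phi> x) a) \<and>
      (\<forall>\<alpha>\<in>carrier \<A>. \<phi> (lsc X \<alpha> x) = lsc Y \<alpha> (\<phi> x) \<and> \<phi> (rsc X x \<alpha>) = rsc Y (\<phi> x) \<alpha>))"

text \<open>
  \<open>is_nth_dual \<A> A M n X\<close>: the structure \<open>X\<close>, whose elements have some type \<open>'u\<close>, is a copy of the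
  \<open>n\<close>-th dual of \<open>M\<close>. As the type \<open>((('m \<Rightarrow> complex) \<Rightarrow> complex) \<dots>) \<Rightarrow> complex\<close> of the literal \<open>n\<close>-th dual
  varies with \<open>n\<close>, each dual is replaced by an isometrically isomorphic copy inside \<open>'u\<close>; \<open>X\<close> is determined up to
  isometric isomorphism of modules. The lemmas \<open>is_nth_dual_0\<close> and \<open>is_nth_dual_step\<close> below show that
  a copy exists for every \<open>n\<close> if \<open>'u\<close> is large enough.
\<close>

primrec is_nth_dual ::
    "('c, 'y) cnspace_scheme \<Rightarrow> ('a, 'z) cnspace_scheme \<Rightarrow> ('c, 'a, 'm) two_module \<Rightarrow> nat \<Rightarrow>
     ('c, 'a, 'u) two_module \<Rightarrow> bool"
  where
    "is_nth_dual \<A> A M 0 X \<longleftrightarrow> (\<exists>\<phi>. isometric_iso \<A> A \<phi> M X)"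
  | "is_nth_dual \<A> A M (Suc n) X \<longleftrightarrow>
       (\<exists>Y :: ('c, 'a, 'u) two_module. is_nth_dual \<A> A M n Y \<and> (\<exists>\<phi>. isometric_iso \<A> A \<phi> (dual Y) X))"

lemma is_nth_dual_0: "is_nth_dual \<A> A M 0 M"
  by (auto simp: isometric_iso_def bij_betw_def intro!: exI[of _ "\<lambda>x. x"])

lemma isometric_iso_trans:
  assumes "isometric_iso \<A> A \<phi> X Y" "isometric_iso \<A> A \<psi> Y Z"
  shows "isometric_iso \<A> A (\<psi> \<circ> \<phi>) X Z"
proof -
  have c: "\<phi> x \<in> carrier Y" if "x \<in> carrier X" for x
    using assms(1) that by (auto simp: isometric_iso_def bij_betw_def)
  have "bij_betw (\<psi> \<circ> \<phi>) (carrier X) (carrier Z)"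
    using assms by (auto simp: isometric_iso_def intro: bij_betw_trans)
  then show ?thesis
    using assms c by (simp add: isometric_iso_def)
qed

definition transport :: "('x \<Rightarrow> 'v) \<Rightarrow> ('c, 'a, 'x) two_module \<Rightarrow> ('c, 'a, 'v) two_module"
  where "transport j X =
    \<lparr>carrier = j ` carrier X, mult = undefined, one = undefined, zero = j \<zero>\<^bsub>X\<^esub>,
     add = (\<lambda>x y. j (inv_into UNIV j x \<oplus>\<^bsub>X\<^esub> inv_into UNIV j y)), smult = (\<lambda>z x. j (z \<odot>\<^bsub>X\<^esub> inv_into UNIV j x)),
     vnorm = (\<lambda>x. vnorm X (inv_into UNIV j x)),
     lact = (\<lambda>a x. j (lact X a (inv_into UNIV j x))), ract = (\<lambda>x a. j (ract X (inv_into UNIV j x) a)),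
     lsc = (\<lambda>\<alpha> x. j (lsc X \<alpha> (inv_into UNIV j x))), rsc = (\<lambda>x \<alpha>. j (rsc X (inv_into UNIV j x) \<alpha>))\<rparr>"

lemma isometric_iso_transport:
  assumes "inj j"
  shows "isometric_iso \<A> A j X (transport j X)"
  using assms by (auto simp: isometric_iso_def transport_def bij_betw_def inj_on_def)

lemma isometric_iso_dual_transport:
  assumes "inj j"
  shows "isometric_iso \<A> A (\<lambda>f. \<lambda>x\<in>carrier X. f (j x)) (dual (transport j X)) (dual X)"
proof -
  let ?F = "\<lambda>f. \<lambda>x\<in>carrier X. f (j x)"
  let ?T = "transport j X"
  let ?G = "\<lambda>g. \<lambda>y\<in>carrier ?T. g (inv_into UNIV j y)"
  have undef: "f (j x) = undefined" if "f \<in> extensional (j ` carrier X)" "x \<notin> carrier X"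
    for f :: "'b \<Rightarrow> complex" and x
    using that assms by (auto simp: extensional_def inj_def)
  have F: "?F f \<in> carrier (dual X)" if "f \<in> carrier (dual ?T)" for f
  proof -
    have e: "f \<in> extensional (j ` carrier X)" and b: "bounded_functional ?T f"
      using that by (auto simp: dual_def transport_def)
    have r: "?F f x = f (j x)" for x
      using undef[OF e] by simp
    have "bounded_functional X (?F f)"
      using b assms unfolding bounded_functional_def r by (simp add: transport_def)
    then show ?thesis by (simp add: dual_def)
  qed
  have G: "?G g \<in> carrier (dual ?T)" if "g \<in> carrier (dual X)" for g
  proof -
    have e: "g \<in> extensional (carrier X)" and b: "bounded_functional X g"
      using that by (auto simp: dual_def)
    have r: "?G g (j x) = g x" for x
      using e assms by (auto simp: transport_def extensional_def inj_def)
    have "?G g \<in> extensional (carrier ?T)" by simp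
    moreover have "bounded_functional ?T (?G g)"
      using b assms r unfolding bounded_functional_def
      by (simp add: transport_def)
    ultimately show ?thesis by (simp add: dual_def)
  qed
  have "bij_betw ?F (carrier (dual ?T)) (carrier (dual X))"
  proof (rule bij_betw_byWitness[where f' = ?G])
    show "\<forall>f\<in>carrier (dual ?T). ?G (?F f) = f"
      using assms by (auto simp: dual_def transport_def fun_eq_iff extensional_def)
    show "\<forall>g\<in>carrier (dual X). ?F (?G g) = g"
      using assms by (auto simp: dual_def transport_def fun_eq_iff extensional_def)
  qed (use F G in auto)
  moreover have "vnorm (dual X) (?F f) = vnorm (dual ?T) f" for f
  proof -
    have "{cmod (?F f x) |x. x \<in> carrier X \<and> vnorm X x \<le> 1} =
          {cmod (f y) |y. y \<in> carrier ?T \<and> vnorm ?T y \<le> 1}"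
      using assms by (auto simp: transport_def)
    then show ?thesis by (simp add: dual_def)
  qed
  ultimately show ?thesis
    using assms undef
    by (auto simp: isometric_iso_def dual_def transport_def fun_eq_iff)
qed

lemma is_nth_dual_transport:
  fixes X :: "('c, 'a, 'u) two_module"
  assumes "inj j" "is_nth_dual \<A> A M n X"
  shows "is_nth_dual \<A> A M n (transport j X)"
  using assms(2)
proof (induction n arbitrary: X)
  case 0
  then show ?case
    using isometric_iso_trans isometric_iso_transport[OF assms(1)] by fastforce
next
  case (Suc n)
  then obtain Y :: "('c, 'a, 'u) two_module" and \<phi>
    where Y: "is_nth_dual \<A> A M n Y" and \<phi>: "isometric_iso \<A> A \<phi> (dual Y) X"
    by auto
  have "\<exists>\<psi>. isometric_iso \<A> A \<psi> (dual (transport j Y)) (transport j X)"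
    using isometric_iso_trans[OF isometric_iso_dual_transport[OF assms(1)]
        isometric_iso_trans[OF \<phi> isometric_iso_transport[OF assms(1)]]] by blast
  then show ?case
    using Suc.IH[OF Y] by auto
qed

lemma is_nth_dual_step:
  fixes X :: "('c, 'a, 'u) two_module"
  assumes "is_nth_dual \<A> A M n X"
  shows "\<exists>Y :: ('c, 'a, 'u \<Rightarrow> complex) two_module. is_nth_dual \<A> A M (Suc n) Y"
proof -
  define j :: "'u \<Rightarrow> 'u \<Rightarrow> complex" where "j x = (\<lambda>y. if y = x then 1 else 0)" for x
  have "inj j"
    by (auto simp: inj_def j_def fun_eq_iff split: if_splits)
  then have "is_nth_dual \<A> A M (Suc n) (dual X)"
    using is_nth_dual_transport[OF _ assms] isometric_iso_dual_transport by fastforce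
  then show ?thesis ..
qed


section \<open>Weak module amenability\<close>

definition module_derivation ::
    "('c, 'y) cnspace_scheme \<Rightarrow> ('c, 'a, 'z) module_alg_scheme \<Rightarrow> ('c, 'a, 'x) two_module \<Rightarrow>
     ('a \<Rightarrow> 'x) \<Rightarrow> bool"
  where "module_derivation \<A> A X D \<longleftrightarrow>
    (\<forall>a\<in>carrier A. D a \<in> carrier X) \<and>
    (\<forall>a\<in>carrier A. \<forall>b\<in>carrier A. D (a \<oplus>\<^bsub>A\<^esub> b) = D a \<oplus>\<^bsub>X\<^esub> D b) \<and>
    (\<forall>\<alpha>\<in>carrier \<A>. \<forall>a\<in>carrier A. D (scl A \<alpha> a) = lsc X \<alpha> (D a) \<and> D (scr A a \<alpha>) = rsc X (D a) \<alpha>) \<and>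
    (\<exists>K>0. \<forall>a\<in>carrier A. vnorm X (D a) \<le> K * vnorm A a) \<and>
    (\<forall>a\<in>carrier A. \<forall>b\<in>carrier A. D (a \<otimes>\<^bsub>A\<^esub> b) = ract X (D a) b \<oplus>\<^bsub>X\<^esub> lact X a (D b))"

definition inner_derivation ::
    "('c, 'a, 'z) module_alg_scheme \<Rightarrow> ('c, 'a, 'x) two_module \<Rightarrow> ('a \<Rightarrow> 'x) \<Rightarrow> bool"
  where "inner_derivation A X D \<longleftrightarrow>
    (\<exists>x\<in>carrier X. \<forall>a\<in>carrier A. D a = lact X a x \<ominus>\<^bsub>X\<^esub> ract X x a)"

text \<open>
  The type argument only fixes where the copies of the \<open>n\<close>-th dual live: the condition has to be
  read as universally quantified over the type \<open>'u\<close>, since it is vacuous for a type that is too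
  small. It is required explicitly that \<open>A\<close> is a Banach algebra with a compatible Banach
  \<open>\<A>\<close>-bimodule structure.
\<close>

definition n_weakly_module_amenable ::
    "'u itself \<Rightarrow> nat \<Rightarrow> ('c, 'y) cnspace_scheme \<Rightarrow> ('c, 'a, 'z) module_alg_scheme \<Rightarrow> bool"
  where "n_weakly_module_amenable _ n \<A> A \<longleftrightarrow>
    banach_module_algebra \<A> A \<and>
    (\<forall>X :: ('c, 'a, 'u) two_module.
      is_nth_dual \<A> A (quotient_module A (module_ideal \<A> A)) n X \<longrightarrow>
        commutative_banach_two_module \<A> A X \<and>
        (\<forall>D. module_derivation \<A> A X D \<longrightarrow> inner_derivation A X D))"


section \<open>Inverse semigroups and their convolution algebras\<close>

class inverse_semigroup = semigroup_mult +
  assumes ex1_inverse: "\<exists>!t. s * t * s = s \<and> t * s * t = t"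

definition star :: "'s::inverse_semigroup \<Rightarrow> 's"
  where "star s = (THE t. s * t * s = s \<and> t * s * t = t)"

definition idempotents :: "'s::inverse_semigroup set"
  where "idempotents = {e. e = star e \<and> e = e * e}"

definition conv :: "('s::semigroup_mult \<Rightarrow> complex) \<Rightarrow> ('s \<Rightarrow> complex) \<Rightarrow> 's \<Rightarrow> complex"
  where "conv f g u = (\<Sum>\<^sub>\<infinity>(s, t) \<in> {(s, t). s * t = u}. f s * g t)"

text \<open>
  For a subsemigroup \<open>T\<close>, the algebra \<open>\<ell>\<^sup>1(T)\<close> is the subalgebra of \<open>\<ell>\<^sup>1(S)\<close> of the functions
  supported in \<open>T\<close>.
\<close>

definition ell1 :: "'s::semigroup_mult set \<Rightarrow> ('s \<Rightarrow> complex) cnspace"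
  where "ell1 T =
    \<lparr>carrier = {f. (\<forall>s. s \<notin> T \<longrightarrow> f s = 0) \<and> (\<lambda>s. cmod (f s)) summable_on UNIV},
     mult = conv, one = undefined,
     zero = (\<lambda>s. 0),
     add = (\<lambda>f g s. f s + g s),
     smult = (\<lambda>z f s. z * f s),
     vnorm = (\<lambda>f. \<Sum>\<^sub>\<infinity>s. cmod (f s))\<rparr>"

text \<open>
  \<open>\<ell>\<^sup>1(S)\<close> with the bilinear continuous extension of
  \<open>\<delta>\<^sub>e \<cdot> \<delta>\<^sub>s = \<delta>\<^sub>s \<cdot> \<delta>\<^sub>e = \<delta>\<^sub>s * \<delta>\<^sub>e\<close> to \<open>\<ell>\<^sup>1(E)\<close> and \<open>\<ell>\<^sup>1(S)\<close>, that is, both actions are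
  convolution on the right.
\<close>

definition ell1_module :: "('s::inverse_semigroup \<Rightarrow> complex, 's \<Rightarrow> complex) module_alg"
  where "ell1_module =
    cnspace.extend (ell1 UNIV)
      (module_alg.fields (\<lambda>\<alpha> a. conv a \<alpha>) (\<lambda>a \<alpha>. conv a \<alpha>))"

definition point_mass :: "'s \<Rightarrow> 's \<Rightarrow> complex"
  where "point_mass s = (\<lambda>t. if t = s then 1 else 0)"

lemma conv_point_mass: "conv (point_mass s) (point_mass t) = point_mass (s * t)"
proof
  fix u
  let ?h = "\<lambda>(x, y). point_mass s x * point_mass t y"
  have "conv (point_mass s) (point_mass t) u = infsum ?h ({(x, y). x * y = u} \<inter> {(s, t)})"
    unfolding conv_def by (rule infsum_cong_neutral) (auto simp: point_mass_def split: if_splits)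
  also have "\<dots> = point_mass (s * t) u"
    by (cases "s * t = u") (auto simp: point_mass_def)
  finally show "conv (point_mass s) (point_mass t) u = point_mass (s * t) u" .
qed

lemma ell1_module_actions:
  "scl ell1_module (point_mass e) (point_mass s) = point_mass (s * e)"
  "scr ell1_module (point_mass s) (point_mass e) = point_mass (s * e)"
  by (simp_all add: ell1_module_def conv_point_mass cnspace.defs module_alg.defs)

end

theory Submission
  imports Defs
begin

text \<open>
  Since \<open>\<ell>\<^sup>1(S)\<close> is commutative, \<open>J = {0}\<close> and the left and right actions of \<open>\<ell>\<^sup>1(S)\<close> on
  every iterated dual \<open>X\<close> coincide, so inner derivations vanish and every module derivation
  \<open>D : \<ell>\<^sup>1(S) \<rightarrow> X\<close> has to be shown to be zero. If \<open>t = t s t\<close>, the Leibniz rule gives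
  \<open>\<delta>\<^bsub>t^k\<^esub> \<cdot> D(\<delta>\<^bsub>s^k\<^esub>) = k \<delta>\<^sub>t \<cdot> D(\<delta>\<^sub>s)\<close> for all \<open>k \<ge> 1\<close>. The left-hand side is bounded in \<open>k\<close>, so
  \<open>\<delta>\<^sub>t \<cdot> D(\<delta>\<^sub>s) = 0\<close>. For \<open>s = t = e\<close> idempotent this yields \<open>D(\<delta>\<^sub>e) = 2 \<delta>\<^sub>e \<cdot> D(\<delta>\<^sub>e) = 0\<close>, and then
  \<open>D(\<delta>\<^sub>s) = \<delta>\<^sub>s\<^sub>s\<^sub>* \<cdot> D(\<delta>\<^sub>s) = 0\<close> for every \<open>s\<close>. Complex multiples of point masses are reached by
  the action of \<open>\<ell>\<^sup>1(E)\<close>, and \<open>D\<close> is additive and bounded.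
\<close>

section \<open>Complex Banach spaces on explicit carriers\<close>

lemma complex_scalars_simps [simp]:
  "carrier complex_scalars = UNIV" "add complex_scalars = (+)" "mult complex_scalars = (*)"
  "one complex_scalars = 1" "zero complex_scalars = 0"
  by (simp_all add: complex_scalars_def)

lemma cring_complex_scalars: "cring complex_scalars"
proof (rule cringI)
  show "abelian_group complex_scalars"
    by (rule abelian_groupI) (auto simp: add.assoc intro: exI[of _ "- x" for x])
  show "comm_monoid complex_scalars"
    by (rule comm_monoidI) auto
qed (auto simp: algebra_simps)

text \<open>The inverse in a HOL-Algebra group is a definite description, so the premises avoid it:
  differences are written \<open>x \<oplus> (-1) \<odot> y\<close>, and \<open>l_distr\<close>,
  \<open>smult_1\<close> and \<open>smult_0\<close> supply the inverses. Convergence is asked for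
  with \<open>\<le> \<epsilon>\<close>, since weak bounds survive passage to a limit.\<close>

lemma cbanach_spaceI:
  fixes X (structure)
  assumes zero: "\<zero> \<in> carrier X"
    and add: "\<And>x y. \<lbrakk>x \<in> carrier X; y \<in> carrier X\<rbrakk> \<Longrightarrow> x \<oplus> y \<in> carrier X"
    and assoc: "\<And>x y z. \<lbrakk>x \<in> carrier X; y \<in> carrier X; z \<in> carrier X\<rbrakk> \<Longrightarrow> (x \<oplus> y) \<oplus> z = x \<oplus> (y \<oplus> z)"
    and comm: "\<And>x y. \<lbrakk>x \<in> carrier X; y \<in> carrier X\<rbrakk> \<Longrightarrow> x \<oplus> y = y \<oplus> x"
    and l_zero: "\<And>x. x \<in> carrier X \<Longrightarrow> \<zero> \<oplus> x = x"
    and smult: "\<And>c x. x \<in> carrier X \<Longrightarrow> c \<odot> x \<in> carrier X"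
    and l_distr: "\<And>c d x. x \<in> carrier X \<Longrightarrow> (c + d) \<odot> x = c \<odot> x \<oplus> d \<odot> x"
    and r_distr: "\<And>c x y. \<lbrakk>x \<in> carrier X; y \<in> carrier X\<rbrakk> \<Longrightarrow> c \<odot> (x \<oplus> y) = c \<odot> x \<oplus> c \<odot> y"
    and smult_assoc: "\<And>c d x. x \<in> carrier X \<Longrightarrow> (c * d) \<odot> x = c \<odot> (d \<odot> x)"
    and smult_1: "\<And>x. x \<in> carrier X \<Longrightarrow> 1 \<odot> x = x"
    and smult_0: "\<And>x. x \<in> carrier X \<Longrightarrow> 0 \<odot> x = \<zero>"
    and norm_0: "\<And>x. x \<in> carrier X \<Longrightarrow> vnorm X x = 0 \<longleftrightarrow> x = \<zero>"
    and norm_triangle: "\<And>x y. \<lbrakk>x \<in> carrier X; y \<in> carrier X\<rbrakk> \<Longrightarrow> vnorm X (x \<oplus> y) \<le> vnorm X x + vnorm X y"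
    and norm_smult: "\<And>c x. x \<in> carrier X \<Longrightarrow> vnorm X (c \<odot> x) = cmod c * vnorm X x"
    and complete: "\<And>\<sigma>. \<lbrakk>\<And>i. \<sigma> i \<in> carrier X;
        \<And>\<epsilon>. \<epsilon> > 0 \<Longrightarrow> \<exists>N. \<forall>i\<ge>N. \<forall>j\<ge>N. vnorm X (\<sigma> i \<oplus> (-1) \<odot> \<sigma> j) < \<epsilon>\<rbrakk>
      \<Longrightarrow> \<exists>x\<in>carrier X. \<forall>\<epsilon>>0. \<exists>N. \<forall>i::nat\<ge>N. vnorm X (\<sigma> i \<oplus> (-1) \<odot> x) \<le> \<epsilon>"
  shows "cbanach_space X"
proof -
  have neg: "(-1) \<odot> x \<oplus> x = \<zero>" if "x \<in> carrier X" for x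
    using l_distr[OF that, of "-1" 1] smult_1[OF that] smult_0[OF that] by simp
  have "abelian_group X"
  proof (rule abelian_groupI)
    fix x assume "x \<in> carrier X"
    then show "\<exists>y\<in>carrier X. y \<oplus> x = \<zero>" using neg smult by blast
  qed (fact assms)+
  then interpret abelian_group X .
  have inv: "\<ominus> x = (-1) \<odot> x" if "x \<in> carrier X" for x
    by (rule minus_equality[OF neg]) (simp_all add: that smult)
  have minus: "x \<ominus> y = x \<oplus> (-1) \<odot> y" if "y \<in> carrier X" for x y
    using that by (simp add: a_minus_def inv)
  \<comment> \<open>The norm axioms do not state positivity; it follows from
    \<open>0 = ||x + (-x)|| <= 2 ||x||\<close>.\<close>
  have nonneg: "0 \<le> vnorm X x" if x: "x \<in> carrier X" for x
    using norm_triangle[OF x smult[OF x, of "-1"]] norm_smult[OF x, of "-1"] norm_0[OF zero]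
      comm[OF x smult[OF x, of "-1"]] neg[OF x] by simp
  have mod: "module complex_scalars X"
    by (rule moduleI, rule cring_complex_scalars, rule abelian_group_axioms)
       (simp_all add: smult l_distr r_distr smult_assoc smult_1)
  interpret cnormed_space X
    by (rule cnormed_space.intro[OF mod], rule cnormed_space_axioms.intro)
      (fact norm_0 norm_triangle norm_smult)+
  show ?thesis
  proof
    fix \<sigma> :: "nat \<Rightarrow> 'a"
    assume \<sigma>: "\<And>i. \<sigma> i \<in> carrier X"
      and cauchy: "\<forall>\<epsilon>>0. \<exists>N. \<forall>i\<ge>N. \<forall>j\<ge>N. vnorm X (\<sigma> i \<ominus> \<sigma> j) < \<epsilon>"
    obtain x where x: "x \<in> carrier X"
      and lim: "\<And>\<epsilon>. \<epsilon> > 0 \<Longrightarrow> \<exists>N. \<forall>i\<ge>N. vnorm X (\<sigma> i \<ominus> x) \<le> \<epsilon>"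
      using complete[of \<sigma>] \<sigma> cauchy by (auto simp: minus)
    have "(\<lambda>i. vnorm X (\<sigma> i \<ominus> x)) \<longlonglongrightarrow> 0"
    proof (rule LIMSEQ_I)
      fix r :: real assume "0 < r"
      \<comment> \<open>Halving \<open>r\<close> turns the weak bound into the strict one required
        below.\<close>
      then obtain N where "\<forall>i\<ge>N. vnorm X (\<sigma> i \<ominus> x) \<le> r / 2"
        using lim[of "r / 2"] by auto
      then show "\<exists>no. \<forall>n\<ge>no. norm (vnorm X (\<sigma> n \<ominus> x) - 0) < r"
        using \<open>0 < r\<close> nonneg \<sigma> x by (intro exI[of _ N]) fastforce
    qed
    with x show "\<exists>x\<in>carrier X. (\<lambda>i. vnorm X (\<sigma> i \<ominus> x)) \<longlonglongrightarrow> 0" ..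
  qed
qed

section \<open>Arithmetic in a complex normed space and positivity of its norm\<close>

context cnormed_space
begin

lemma smult_0_left [simp]: "x \<in> carrier X \<Longrightarrow> 0 \<odot> x = \<zero>"
  using smult_l_null by simp

lemma smult_0_right [simp]: "c \<odot> \<zero> = \<zero>"
  using smult_r_null by simp

lemma smult_in [simp]: "x \<in> carrier X \<Longrightarrow> c \<odot> x \<in> carrier X"
  using smult_closed by simp

lemma smult_one_left [simp]: "x \<in> carrier X \<Longrightarrow> 1 \<odot> x = x"
  using smult_one by simp

lemma smult_add_left: "x \<in> carrier X \<Longrightarrow> (c + d) \<odot> x = c \<odot> x \<oplus> d \<odot> x"
  using smult_l_distr by simp

lemma smult_add_right: "\<lbrakk>x \<in> carrier X; y \<in> carrier X\<rbrakk> \<Longrightarrow> c \<odot> (x \<oplus> y) = c \<odot> x \<oplus> c \<odot> y"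
  using smult_r_distr by simp

lemma smult_smult: "x \<in> carrier X \<Longrightarrow> (c * d) \<odot> x = c \<odot> (d \<odot> x)"
  using smult_assoc1 by simp

lemma a_inv_eq_smult: "x \<in> carrier X \<Longrightarrow> \<ominus> x = (-1) \<odot> x"
  using smult_add_left[of x "-1" 1] by (intro minus_equality) simp_all

lemma minus_eq_smult: "y \<in> carrier X \<Longrightarrow> x \<ominus> y = x \<oplus> (-1) \<odot> y"
  by (simp add: a_minus_def a_inv_eq_smult)

lemma vnorm_zero [simp]: "vnorm X \<zero> = 0"
  by (simp add: vnorm_eq_0)

lemma vnorm_nonneg: "x \<in> carrier X \<Longrightarrow> 0 \<le> vnorm X x"
  using vnorm_triangle[of x "\<ominus> x"] vnorm_smult[of x "-1"] r_neg[of x]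
  by (simp add: a_inv_eq_smult)

end


section \<open>Duals\<close>

lemma restrict_in_dual:
  assumes "cnormed_space X"
    and "\<And>x y. \<lbrakk>x \<in> carrier X; y \<in> carrier X\<rbrakk> \<Longrightarrow> f (x \<oplus>\<^bsub>X\<^esub> y) = f x + f y"
    and "\<And>z x. x \<in> carrier X \<Longrightarrow> f (z \<odot>\<^bsub>X\<^esub> x) = z * f x"
    and "\<And>x. x \<in> carrier X \<Longrightarrow> cmod (f x) \<le> K * vnorm X x"
  shows "restrict f (carrier X) \<in> carrier (dual X)"
proof -
  interpret cnormed_space X by fact
  show ?thesis
    using assms(2-4) by (auto simp: dual_def bounded_functional_def intro!: exI[of _ K])
qed

lemma dual_add:
  assumes "f \<in> carrier (dual X)" "x \<in> carrier X" "y \<in> carrier X"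
  shows "f (x \<oplus>\<^bsub>X\<^esub> y) = f x + f y"
  using assms by (simp add: dual_def bounded_functional_def)

lemma dual_smult:
  assumes "f \<in> carrier (dual X)" "x \<in> carrier X"
  shows "f (z \<odot>\<^bsub>X\<^esub> x) = z * f x"
  using assms by (simp add: dual_def bounded_functional_def)

lemma dual_eqI:
  assumes "f \<in> carrier (dual X)" "g \<in> carrier (dual X)" "\<And>x. x \<in> carrier X \<Longrightarrow> f x = g x"
  shows "f = g"
  using assms by (auto simp: dual_def intro: extensionalityI)

text \<open>Rescaling \<open>x\<close> to norm 1 places the value of \<open>f\<close> under the
  supremum. The set of values is bounded because \<open>f\<close> is a bounded functional, so the
  real \<open>Sup\<close> is a genuine upper bound.\<close>

lemma vnorm_dual_le:
  assumes "cnormed_space X" "f \<in> carrier (dual X)" "x \<in> carrier X"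
  shows "cmod (f x) \<le> vnorm (dual X) f * vnorm X x"
proof -
  interpret cnormed_space X by fact
  let ?S = "{cmod (f x) | x. x \<in> carrier X \<and> vnorm X x \<le> 1}"
  obtain K where K: "\<And>x. x \<in> carrier X \<Longrightarrow> cmod (f x) \<le> K * vnorm X x"
    using assms(2) unfolding dual_def bounded_functional_def by fastforce
  have bdd: "bdd_above ?S"
  proof (rule bdd_aboveI)
    fix y assume "y \<in> ?S"
    then obtain x where x: "x \<in> carrier X" "vnorm X x \<le> 1" "y = cmod (f x)" by auto
    \<comment> \<open>The constant \<open>K\<close> comes without a sign, hence the absolute
      value.\<close>
    have "K * vnorm X x \<le> \<bar>K\<bar> * 1"
      using x vnorm_nonneg[OF x(1)] by (intro mult_mono) auto
    then show "y \<le> \<bar>K\<bar>" using K[OF x(1)] x(3) by simp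
  qed
  show ?thesis
  proof (cases "vnorm X x = 0")
    case True
    then show ?thesis using K[OF assms(3)] by simp
  next
    case False
    define r where "r = vnorm X x"
    have r: "r > 0" using False vnorm_nonneg[OF assms(3)] by (simp add: r_def)
    let ?y = "complex_of_real (inverse r) \<odot>\<^bsub>X\<^esub> x"
    have "vnorm X ?y = 1"
      using r assms(3) by (simp add: vnorm_smult r_def[symmetric] norm_inverse)
    then have "cmod (f ?y) \<in> ?S"
      using assms(3) by (auto intro!: exI[of _ ?y])
    then have "cmod (f ?y) \<le> Sup ?S"
      using bdd by (rule cSup_upper)
    also have "f ?y = complex_of_real (inverse r) * f x"
      by (rule dual_smult) fact+
    finally have "inverse r * cmod (f x) \<le> vnorm (dual X) f"
      using r by (simp add: dual_def norm_mult norm_inverse)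
    then show ?thesis
      using r by (simp add: field_simps r_def[symmetric])
  qed
qed

lemma vnorm_dual_leI:
  assumes "cnormed_space X" "0 \<le> C" "\<And>x. x \<in> carrier X \<Longrightarrow> cmod (f x) \<le> C * vnorm X x"
  shows "vnorm (dual X) f \<le> C"
proof -
  interpret cnormed_space X by fact
  have "Sup {cmod (f x) | x. x \<in> carrier X \<and> vnorm X x \<le> 1} \<le> C"
  proof (rule cSup_least)
    show "{cmod (f x) | x. x \<in> carrier X \<and> vnorm X x \<le> 1} \<noteq> {}"
      by (auto intro!: exI[of _ "\<zero>\<^bsub>X\<^esub>"])
    fix y assume "y \<in> {cmod (f x) | x. x \<in> carrier X \<and> vnorm X x \<le> 1}"
    then obtain x where x: "x \<in> carrier X" "vnorm X x \<le> 1" "y = cmod (f x)" by auto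
    have "C * vnorm X x \<le> C * 1"
      by (rule mult_left_mono) (use x assms(2) in auto)
    then show "y \<le> C" using assms(3)[OF x(1)] x(3) by simp
  qed
  then show ?thesis by (simp add: dual_def)
qed

text \<open>A negative norm would force all values of \<open>f\<close> to vanish by
  \<open>vnorm_dual_le\<close>; but then the supremum is taken over \<open>{0}\<close> and equals
  0.\<close>

lemma vnorm_dual_nonneg:
  assumes "cnormed_space X" "f \<in> carrier (dual X)"
  shows "0 \<le> vnorm (dual X) f"
proof (rule ccontr)
  interpret cnormed_space X by fact
  assume neg: "\<not> 0 \<le> vnorm (dual X) f"
  have "f x = 0" if x: "x \<in> carrier X" for x
    using vnorm_dual_le[OF assms x] mult_nonpos_nonneg[of "vnorm (dual X) f" "vnorm X x"]
      neg vnorm_nonneg[OF x] by (smt (verit) norm_ge_zero norm_le_zero_iff)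
  then have "{cmod (f x) | x. x \<in> carrier X \<and> vnorm X x \<le> 1} = {0}"
    by (auto intro!: exI[of _ "\<zero>\<^bsub>X\<^esub>"])
  then have "vnorm (dual X) f = 0" by (simp add: dual_def)
  with neg show False by simp
qed

section \<open>The dual as a Banach space\<close>

lemma dual_closed:
  assumes "cnormed_space X"
  shows "\<zero>\<^bsub>dual X\<^esub> \<in> carrier (dual X)"
    and "\<lbrakk>f \<in> carrier (dual X); g \<in> carrier (dual X)\<rbrakk> \<Longrightarrow> f \<oplus>\<^bsub>dual X\<^esub> g \<in> carrier (dual X)"
    and "f \<in> carrier (dual X) \<Longrightarrow> z \<odot>\<^bsub>dual X\<^esub> f \<in> carrier (dual X)"
proof -
  show "\<zero>\<^bsub>dual X\<^esub> \<in> carrier (dual X)"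
    using restrict_in_dual[OF assms, of "\<lambda>x. 0" 0] by (simp add: dual_def)
next
  assume f: "f \<in> carrier (dual X)" and g: "g \<in> carrier (dual X)"
  have "restrict (\<lambda>x. f x + g x) (carrier X) \<in> carrier (dual X)"
  proof (rule restrict_in_dual[OF assms])
    fix x assume x: "x \<in> carrier X"
    show "cmod (f x + g x) \<le> (vnorm (dual X) f + vnorm (dual X) g) * vnorm X x"
      using vnorm_dual_le[OF assms f x] vnorm_dual_le[OF assms g x]
      by (auto simp: distrib_right intro: norm_triangle_le)
  qed (use f g in \<open>simp_all add: dual_add dual_smult algebra_simps\<close>)
  then show "f \<oplus>\<^bsub>dual X\<^esub> g \<in> carrier (dual X)"
    by (simp add: dual_def)
next
  assume f: "f \<in> carrier (dual X)"
  have "restrict (\<lambda>x. z * f x) (carrier X) \<in> carrier (dual X)"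
  proof (rule restrict_in_dual[OF assms])
    fix x assume x: "x \<in> carrier X"
    show "cmod (z * f x) \<le> (cmod z * vnorm (dual X) f) * vnorm X x"
      using vnorm_dual_le[OF assms f x] by (simp add: norm_mult mult.assoc mult_left_mono)
  qed (use f in \<open>simp_all add: dual_add dual_smult algebra_simps\<close>)
  then show "z \<odot>\<^bsub>dual X\<^esub> f \<in> carrier (dual X)"
    by (simp add: dual_def)
qed

lemma dual_apply:
  assumes "x \<in> carrier X"
  shows "(f \<oplus>\<^bsub>dual X\<^esub> g) x = f x + g x" "(z \<odot>\<^bsub>dual X\<^esub> f) x = z * f x" "\<zero>\<^bsub>dual X\<^esub> x = 0"
  using assms by (simp_all add: dual_def)

lemma dual_ops:
  "f \<oplus>\<^bsub>dual X\<^esub> g = (\<lambda>x\<in>carrier X. f x + g x)" "z \<odot>\<^bsub>dual X\<^esub> f = (\<lambda>x\<in>carrier X. z * f x)"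
  by (simp_all add: dual_def)

text \<open>One half of homogeneity; the other half follows by applying it once more with the
  inverse scalar.\<close>

lemma vnorm_dual_smult_le:
  assumes "cnormed_space X" "f \<in> carrier (dual X)"
  shows "vnorm (dual X) (z \<odot>\<^bsub>dual X\<^esub> f) \<le> cmod z * vnorm (dual X) f"
proof (rule vnorm_dual_leI[OF assms(1)])
  fix x assume x: "x \<in> carrier X"
  show "cmod ((z \<odot>\<^bsub>dual X\<^esub> f) x) \<le> cmod z * vnorm (dual X) f * vnorm X x"
    using vnorm_dual_le[OF assms x] x by (simp add: dual_apply norm_mult mult.assoc mult_left_mono)
qed (use vnorm_dual_nonneg[OF assms] in simp)

lemma cbanach_space_dual:
  assumes X: "cnormed_space X"
  shows "cbanach_space (dual X)"
proof (rule cbanach_spaceI)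
  interpret cnormed_space X by fact
  note [simp] = dual_closed[OF X] dual_apply
  fix f g h c d
  show "\<zero>\<^bsub>dual X\<^esub> \<in> carrier (dual X)" by simp
  assume f: "f \<in> carrier (dual X)"
  show "c \<odot>\<^bsub>dual X\<^esub> f \<in> carrier (dual X)"
    using f by simp
  show "\<zero>\<^bsub>dual X\<^esub> \<oplus>\<^bsub>dual X\<^esub> f = f" "1 \<odot>\<^bsub>dual X\<^esub> f = f" "0 \<odot>\<^bsub>dual X\<^esub> f = \<zero>\<^bsub>dual X\<^esub>"
    "(c * d) \<odot>\<^bsub>dual X\<^esub> f = c \<odot>\<^bsub>dual X\<^esub> (d \<odot>\<^bsub>dual X\<^esub> f)"
    "(c + d) \<odot>\<^bsub>dual X\<^esub> f = c \<odot>\<^bsub>dual X\<^esub> f \<oplus>\<^bsub>dual X\<^esub> d \<odot>\<^bsub>dual X\<^esub> f"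
    using f by (auto intro!: dual_eqI[where X = X] simp: algebra_simps)
  show "vnorm (dual X) f = 0 \<longleftrightarrow> f = \<zero>\<^bsub>dual X\<^esub>"
  proof
    assume "vnorm (dual X) f = 0"
    then show "f = \<zero>\<^bsub>dual X\<^esub>"
      using vnorm_dual_le[OF X f] f by (intro dual_eqI[where X = X]) simp_all
  next
    assume "f = \<zero>\<^bsub>dual X\<^esub>"
    then show "vnorm (dual X) f = 0"
      using vnorm_dual_leI[OF X, of 0 f] vnorm_dual_nonneg[OF X f] by simp
  qed
  show "vnorm (dual X) (c \<odot>\<^bsub>dual X\<^esub> f) = cmod c * vnorm (dual X) f"
  proof (rule antisym)
    show "vnorm (dual X) (c \<odot>\<^bsub>dual X\<^esub> f) \<le> cmod c * vnorm (dual X) f"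
      by (rule vnorm_dual_smult_le[OF X f])
    show "cmod c * vnorm (dual X) f \<le> vnorm (dual X) (c \<odot>\<^bsub>dual X\<^esub> f)"
    proof (cases "c = 0")
      case True
      then show ?thesis using vnorm_dual_nonneg[OF X dual_closed(3)[OF X f, of c]] by simp
    next
      case False
      \<comment> \<open>Undoing the multiplication by \<open>c\<close> reduces the reverse
        inequality to \<open>vnorm_dual_smult_le\<close> for \<open>inverse c\<close>.\<close>
      have "inverse c \<odot>\<^bsub>dual X\<^esub> (c \<odot>\<^bsub>dual X\<^esub> f) = f"
        using False f by (intro dual_eqI[where X = X]) simp_all
      then have "vnorm (dual X) f \<le> inverse (cmod c) * vnorm (dual X) (c \<odot>\<^bsub>dual X\<^esub> f)"
        using vnorm_dual_smult_le[OF X dual_closed(3)[OF X f, of c], of "inverse c"]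
        by (simp add: norm_inverse)
      then show ?thesis using False by (simp add: field_simps)
    qed
  qed
  assume g: "g \<in> carrier (dual X)"
  show "f \<oplus>\<^bsub>dual X\<^esub> g \<in> carrier (dual X)"
    using f g by simp
  show "f \<oplus>\<^bsub>dual X\<^esub> g = g \<oplus>\<^bsub>dual X\<^esub> f"
    "c \<odot>\<^bsub>dual X\<^esub> (f \<oplus>\<^bsub>dual X\<^esub> g) = c \<odot>\<^bsub>dual X\<^esub> f \<oplus>\<^bsub>dual X\<^esub> c \<odot>\<^bsub>dual X\<^esub> g"
    using f g by (auto intro!: dual_eqI[where X = X] simp: algebra_simps)
  show "vnorm (dual X) (f \<oplus>\<^bsub>dual X\<^esub> g) \<le> vnorm (dual X) f + vnorm (dual X) g"
  proof (rule vnorm_dual_leI[OF X])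
    fix x assume x: "x \<in> carrier X"
    show "cmod ((f \<oplus>\<^bsub>dual X\<^esub> g) x) \<le> (vnorm (dual X) f + vnorm (dual X) g) * vnorm X x"
      using vnorm_dual_le[OF X f x] vnorm_dual_le[OF X g x] x
      by (auto simp: distrib_right intro: norm_triangle_le)
  qed (use vnorm_dual_nonneg[OF X] f g in simp)
  assume h: "h \<in> carrier (dual X)"
  show "(f \<oplus>\<^bsub>dual X\<^esub> g) \<oplus>\<^bsub>dual X\<^esub> h = f \<oplus>\<^bsub>dual X\<^esub> (g \<oplus>\<^bsub>dual X\<^esub> h)"
    using f g h by (intro dual_eqI[where X = X]) simp_all
next
  interpret cnormed_space X by fact
  note [simp] = dual_closed[OF X] dual_apply
  fix \<sigma> :: "nat \<Rightarrow> _"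
  assume \<sigma>: "\<And>i. \<sigma> i \<in> carrier (dual X)"
    and cauchy: "\<And>\<epsilon>. \<epsilon> > 0 \<Longrightarrow>
      \<exists>N. \<forall>i\<ge>N. \<forall>j\<ge>N. vnorm (dual X) (\<sigma> i \<oplus>\<^bsub>dual X\<^esub> (-1) \<odot>\<^bsub>dual X\<^esub> \<sigma> j) < \<epsilon>"
  have diff: "cmod (\<sigma> i x - \<sigma> j x) \<le> vnorm (dual X) (\<sigma> i \<oplus>\<^bsub>dual X\<^esub> (-1) \<odot>\<^bsub>dual X\<^esub> \<sigma> j) * vnorm X x"
    if "x \<in> carrier X" for x i j
    using vnorm_dual_le[OF X dual_closed(2)[OF X \<sigma> dual_closed(3)[OF X \<sigma>]] that, of i "-1" j] that
    by simp
  \<comment> \<open>The Cauchy condition, spelled out pointwise but uniformly in \<open>x\<close>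
    relative to \<open>vnorm X x\<close>. Both the pointwise limit and the convergence in norm are
    extracted from it.\<close>
  have unif: "\<exists>N. \<forall>i\<ge>N. \<forall>j\<ge>N. \<forall>x\<in>carrier X. cmod (\<sigma> i x - \<sigma> j x) \<le> \<epsilon> * vnorm X x" if "\<epsilon> > 0" for \<epsilon>
  proof -
    obtain N where N: "\<And>i j. i \<ge> N \<Longrightarrow> j \<ge> N \<Longrightarrow>
        vnorm (dual X) (\<sigma> i \<oplus>\<^bsub>dual X\<^esub> (-1) \<odot>\<^bsub>dual X\<^esub> \<sigma> j) < \<epsilon>"
      using cauchy[OF \<open>\<epsilon> > 0\<close>] by blast
    have "cmod (\<sigma> i x - \<sigma> j x) \<le> \<epsilon> * vnorm X x" if "i \<ge> N" "j \<ge> N" "x \<in> carrier X" for i j x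
      using diff[OF that(3), of i j] mult_right_mono[OF less_imp_le[OF N[OF that(1,2)]] vnorm_nonneg[OF that(3)]]
      by linarith
    then show ?thesis by blast
  qed
  have conv: "convergent (\<lambda>i. \<sigma> i x)" if x: "x \<in> carrier X" for x
  proof (rule Cauchy_convergent, rule metric_CauchyI)
    fix e :: real assume e: "e > 0"
    \<comment> \<open>Adding 1 keeps the denominator positive when \<open>x\<close> has norm
      0.\<close>
    have pos: "e / (2 * (vnorm X x + 1)) > 0"
      using e vnorm_nonneg[OF x] by simp
    have less: "e / (2 * (vnorm X x + 1)) * vnorm X x < e"
      using e vnorm_nonneg[OF x] by (simp add: field_simps add_nonneg_pos)
    show "\<exists>M. \<forall>m\<ge>M. \<forall>n\<ge>M. dist (\<sigma> m x) (\<sigma> n x) < e"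
      using unif[OF pos] x less unfolding dist_norm by (meson le_less_trans)
  qed
  define f where "f = (\<lambda>x\<in>carrier X. lim (\<lambda>i. \<sigma> i x))"
  have lim: "(\<lambda>i. \<sigma> i x) \<longlonglongrightarrow> f x" if "x \<in> carrier X" for x
    using conv[OF that] that by (simp add: f_def convergent_LIMSEQ_iff)
  \<comment> \<open>The uniform estimate persists when \<open>j\<close> tends to infinity with
    \<open>i\<close> fixed.\<close>
  have close: "\<exists>N. \<forall>i\<ge>N. \<forall>x\<in>carrier X. cmod (\<sigma> i x - f x) \<le> \<epsilon> * vnorm X x" if "\<epsilon> > 0" for \<epsilon>
  proof -
    obtain N where N: "\<And>i j x. i \<ge> N \<Longrightarrow> j \<ge> N \<Longrightarrow> x \<in> carrier X \<Longrightarrow> cmod (\<sigma> i x - \<sigma> j x) \<le> \<epsilon> * vnorm X x"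
      using unif[OF \<open>\<epsilon> > 0\<close>] by blast
    have "cmod (\<sigma> i x - f x) \<le> \<epsilon> * vnorm X x" if "i \<ge> N" "x \<in> carrier X" for i x
    proof (rule Lim_bounded)
      show "(\<lambda>j. cmod (\<sigma> i x - \<sigma> j x)) \<longlonglongrightarrow> cmod (\<sigma> i x - f x)"
        by (intro tendsto_intros lim that)
      show "\<forall>j\<ge>N. cmod (\<sigma> i x - \<sigma> j x) \<le> \<epsilon> * vnorm X x"
        using N that by blast
    qed
    then show ?thesis by blast
  qed
  \<comment> \<open>A single index with error at most \<open>vnorm X x\<close> suffices for
    boundedness of the limit, with constant \<open>vnorm (dual X) (\<sigma> N) + 1\<close>.\<close>
  obtain N where N: "\<And>x. x \<in> carrier X \<Longrightarrow> cmod (\<sigma> N x - f x) \<le> 1 * vnorm X x"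
    using close[of 1] by auto
  have "restrict f (carrier X) \<in> carrier (dual X)"
  proof (rule restrict_in_dual[OF X])
    fix x y assume "x \<in> carrier X" "y \<in> carrier X"
    then show "f (x \<oplus>\<^bsub>X\<^esub> y) = f x + f y"
      using lim[of "x \<oplus>\<^bsub>X\<^esub> y"] tendsto_add[OF lim[of x] lim[of y]] \<sigma>
      by (simp add: dual_add LIMSEQ_unique)
  next
    fix x z assume "x \<in> carrier X"
    then show "f (z \<odot>\<^bsub>X\<^esub> x) = z * f x"
      using lim[of "z \<odot>\<^bsub>X\<^esub> x"] tendsto_mult_left[OF lim[of x], of z] \<sigma>
      by (simp add: dual_smult LIMSEQ_unique)
  next
    fix x assume x: "x \<in> carrier X"
    have "cmod (f x) \<le> cmod (\<sigma> N x) + cmod (\<sigma> N x - f x)"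
      by norm
    also have "\<dots> \<le> vnorm (dual X) (\<sigma> N) * vnorm X x + 1 * vnorm X x"
      using N[OF x] vnorm_dual_le[OF X \<sigma> x] by (rule add_mono[rotated])
    finally show "cmod (f x) \<le> (vnorm (dual X) (\<sigma> N) + 1) * vnorm X x"
      by (simp add: distrib_right)
  qed
  moreover have "restrict f (carrier X) = f" by (simp add: f_def)
  ultimately have f: "f \<in> carrier (dual X)" by simp
  have "\<exists>N. \<forall>i\<ge>N. vnorm (dual X) (\<sigma> i \<oplus>\<^bsub>dual X\<^esub> (-1) \<odot>\<^bsub>dual X\<^esub> f) \<le> \<epsilon>" if \<epsilon>: "\<epsilon> > 0" for \<epsilon>
  proof -
    obtain N where N: "\<And>i x. i \<ge> N \<Longrightarrow> x \<in> carrier X \<Longrightarrow> cmod (\<sigma> i x - f x) \<le> \<epsilon> * vnorm X x"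
      using close[OF \<epsilon>] by blast
    have "vnorm (dual X) (\<sigma> i \<oplus>\<^bsub>dual X\<^esub> (-1) \<odot>\<^bsub>dual X\<^esub> f) \<le> \<epsilon>" if "i \<ge> N" for i
      using \<epsilon> N[OF that] by (intro vnorm_dual_leI[OF X]) auto
    then show ?thesis by blast
  qed
  with f show "\<exists>x\<in>carrier (dual X). \<forall>\<epsilon>>0. \<exists>N. \<forall>i\<ge>N.
      vnorm (dual X) (\<sigma> i \<oplus>\<^bsub>dual X\<^esub> (-1) \<odot>\<^bsub>dual X\<^esub> x) \<le> \<epsilon>"
    by blast
qed

text \<open>The left action on the dual is the transpose of the right action on \<open>X\<close> and
  vice versa. Transposition reverses the order of composition, so \<open>l_mult\<close> for the dual
  comes from \<open>r_mult\<close> for \<open>X\<close>, and \<open>r_mult\<close> from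
  \<open>l_mult\<close>.\<close>

lemma banach_bimodule_dual:
  assumes "banach_bimodule B X l r"
  shows "banach_bimodule B (dual X) (\<lambda>b f. \<lambda>x\<in>carrier X. f (r x b)) (\<lambda>f b. \<lambda>x\<in>carrier X. f (l b x))"
proof -
  interpret banach_bimodule B X l r by fact
  note X = X.cnormed_space_axioms
  note [simp] = dual_closed[OF X] dual_apply l_closed r_closed
  \<comment> \<open>Treats both transposes at once: \<open>h\<close> stands for either action, seen
    as a family of linear maps indexed by \<open>b\<close> and bounded by a multiple of
    \<open>vnorm B b\<close>. Passing to \<open>\<bar>K\<bar>\<close> covers a negative
    constant.\<close>
  have bound: "\<exists>K\<ge>0. \<forall>f\<in>carrier (dual X). \<forall>b\<in>carrier B.
      restrict (\<lambda>x. f (h b x)) (carrier X) \<in> carrier (dual X) \<and>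
      vnorm (dual X) (restrict (\<lambda>x. f (h b x)) (carrier X)) \<le> K * vnorm B b * vnorm (dual X) f"
    if h: "\<And>b x. b \<in> carrier B \<Longrightarrow> x \<in> carrier X \<Longrightarrow> h b x \<in> carrier X"
      "\<And>b x y. b \<in> carrier B \<Longrightarrow> x \<in> carrier X \<Longrightarrow> y \<in> carrier X \<Longrightarrow> h b (x \<oplus>\<^bsub>X\<^esub> y) = h b x \<oplus>\<^bsub>X\<^esub> h b y"
      "\<And>b x z. b \<in> carrier B \<Longrightarrow> x \<in> carrier X \<Longrightarrow> h b (z \<odot>\<^bsub>X\<^esub> x) = z \<odot>\<^bsub>X\<^esub> h b x"
    and K: "\<And>b x. b \<in> carrier B \<Longrightarrow> x \<in> carrier X \<Longrightarrow> vnorm X (h b x) \<le> K * vnorm B b * vnorm X x"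
    for h K
  proof -
    have le: "cmod (f (h b x)) \<le> (\<bar>K\<bar> * vnorm B b * vnorm (dual X) f) * vnorm X x"
      if f: "f \<in> carrier (dual X)" and b: "b \<in> carrier B" and x: "x \<in> carrier X" for f b x
    proof -
      have "cmod (f (h b x)) \<le> vnorm (dual X) f * vnorm X (h b x)"
        by (rule vnorm_dual_le[OF X f h(1)[OF b x]])
      also have "\<dots> \<le> vnorm (dual X) f * (K * vnorm B b * vnorm X x)"
        by (rule mult_left_mono[OF K[OF b x] vnorm_dual_nonneg[OF X f]])
      also have "\<dots> \<le> vnorm (dual X) f * (\<bar>K\<bar> * vnorm B b * vnorm X x)"
        using vnorm_dual_nonneg[OF X f] B.vnorm_nonneg[OF b] X.vnorm_nonneg[OF x]
        by (intro mult_left_mono mult_right_mono) auto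
      finally show ?thesis by (simp add: mult_ac)
    qed
    have "restrict (\<lambda>x. f (h b x)) (carrier X) \<in> carrier (dual X)"
      if f: "f \<in> carrier (dual X)" and b: "b \<in> carrier B" for f b
      using le[OF f b] by (rule restrict_in_dual[OF X, rotated 2]) (use f b h in \<open>simp_all add: dual_add dual_smult\<close>)
    moreover have "vnorm (dual X) (restrict (\<lambda>x. f (h b x)) (carrier X)) \<le> \<bar>K\<bar> * vnorm B b * vnorm (dual X) f"
      if f: "f \<in> carrier (dual X)" and b: "b \<in> carrier B" for f b
      by (rule vnorm_dual_leI[OF X])
        (use le[OF f b] vnorm_dual_nonneg[OF X f] B.vnorm_nonneg[OF b] in auto)
    ultimately show ?thesis by (intro exI[of _ "\<bar>K\<bar>"]) auto
  qed
  obtain K where K: "\<And>b x. b \<in> carrier B \<Longrightarrow> x \<in> carrier X \<Longrightarrow> vnorm X (l b x) \<le> K * vnorm B b * vnorm X x"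
    using l_bounded by blast
  have "\<exists>K\<ge>0. \<forall>f\<in>carrier (dual X). \<forall>b\<in>carrier B.
      restrict (\<lambda>x. f (l b x)) (carrier X) \<in> carrier (dual X) \<and>
      vnorm (dual X) (restrict (\<lambda>x. f (l b x)) (carrier X)) \<le> K * vnorm B b * vnorm (dual X) f"
    by (rule bound[of l, OF _ _ _ K]) (simp_all add: l_add2 l_smult2)
  then obtain K1 where K1: "\<And>f b. f \<in> carrier (dual X) \<Longrightarrow> b \<in> carrier B \<Longrightarrow>
      restrict (\<lambda>x. f (l b x)) (carrier X) \<in> carrier (dual X)"
    "\<And>f b. f \<in> carrier (dual X) \<Longrightarrow> b \<in> carrier B \<Longrightarrow>
      vnorm (dual X) (restrict (\<lambda>x. f (l b x)) (carrier X)) \<le> K1 * vnorm B b * vnorm (dual X) f"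
    by blast
  obtain K' where K': "\<And>b x. b \<in> carrier B \<Longrightarrow> x \<in> carrier X \<Longrightarrow> vnorm X (r x b) \<le> K' * vnorm B b * vnorm X x"
    using r_bounded by blast
  have "\<exists>K\<ge>0. \<forall>f\<in>carrier (dual X). \<forall>b\<in>carrier B.
      restrict (\<lambda>x. f (r x b)) (carrier X) \<in> carrier (dual X) \<and>
      vnorm (dual X) (restrict (\<lambda>x. f (r x b)) (carrier X)) \<le> K * vnorm B b * vnorm (dual X) f"
    by (rule bound[of "\<lambda>b x. r x b", OF _ _ _ K']) (simp_all add: r_add2 r_smult2)
  then obtain K2 where K2: "\<And>f b. f \<in> carrier (dual X) \<Longrightarrow> b \<in> carrier B \<Longrightarrow>
      restrict (\<lambda>x. f (r x b)) (carrier X) \<in> carrier (dual X)"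
    "\<And>f b. f \<in> carrier (dual X) \<Longrightarrow> b \<in> carrier B \<Longrightarrow>
      vnorm (dual X) (restrict (\<lambda>x. f (r x b)) (carrier X)) \<le> K2 * vnorm B b * vnorm (dual X) f"
    by blast
  show ?thesis
  proof (intro banach_bimodule.intro banach_bimodule_axioms.intro)
    show "cbanach_algebra B" by unfold_locales
    show "cbanach_space (dual X)" by (rule cbanach_space_dual[OF X])
    show "\<exists>K. \<forall>b\<in>carrier B. \<forall>f\<in>carrier (dual X).
        vnorm (dual X) (\<lambda>x\<in>carrier X. f (r x b)) \<le> K * vnorm B b * vnorm (dual X) f"
      using K2(2) by blast
    show "\<exists>K. \<forall>b\<in>carrier B. \<forall>f\<in>carrier (dual X).
        vnorm (dual X) (\<lambda>x\<in>carrier X. f (l b x)) \<le> K * vnorm B b * vnorm (dual X) f"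
      using K1(2) by blast
    fix b f assume b: "b \<in> carrier B" and f: "f \<in> carrier (dual X)"
    show "restrict (\<lambda>x. f (r x b)) (carrier X) \<in> carrier (dual X)"
      "restrict (\<lambda>x. f (l b x)) (carrier X) \<in> carrier (dual X)"
      using K1(1)[OF f b] K2(1)[OF f b] by simp_all
  qed (simp_all add: dual_ops fun_eq_iff l_add1 l_smult1 r_add1 r_smult1 dual_add dual_smult l_mult r_mult l_r
      B.mult_closed)
qed

lemma dual_actions:
  "lact (dual X) = (\<lambda>a f. \<lambda>x\<in>carrier X. f (ract X x a))"
  "ract (dual X) = (\<lambda>f a. \<lambda>x\<in>carrier X. f (lact X a x))"
  "lsc (dual X) = (\<lambda>\<alpha> f. \<lambda>x\<in>carrier X. f (rsc X x \<alpha>))"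
  "rsc (dual X) = (\<lambda>f \<alpha>. \<lambda>x\<in>carrier X. f (lsc X \<alpha> x))"
  by (simp_all add: dual_def)

text \<open>Each compatibility law of the dual is the transpose of a law of \<open>X\<close> with
  left and right exchanged. This pairs \<open>lsc_lact\<close> with \<open>ract_scl\<close>,
  \<open>lsc_ract\<close> with \<open>lact_rsc\<close>, and \<open>lact_lsc\<close> with
  \<open>ract_scr\<close>.\<close>

lemma commutative_banach_two_module_dual:
  assumes "commutative_banach_two_module \<A> A X"
  shows "commutative_banach_two_module \<A> A (dual X)"
proof -
  interpret commutative_banach_two_module \<A> A X by fact
  note closed = AX.l_closed AX.r_closed CX.l_closed CX.r_closed
  show ?thesis
  proof (intro commutative_banach_two_module.intro banach_two_module.intro)
    show "banach_bimodule A (dual X) (lact (dual X)) (ract (dual X))"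
      "banach_bimodule \<A> (dual X) (lsc (dual X)) (rsc (dual X))"
      unfolding dual_actions by (rule banach_bimodule_dual[OF AX.banach_bimodule_axioms] banach_bimodule_dual[OF CX.banach_bimodule_axioms])+
    show "banach_two_module_axioms \<A> A (dual X)"
      by (intro banach_two_module_axioms.intro) (auto simp: dual_actions fun_eq_iff closed lsc_lact lsc_ract ract_scr lact_rsc lact_lsc ract_scl)
    show "commutative_banach_two_module_axioms \<A> (dual X)"
      by (intro commutative_banach_two_module_axioms.intro) (auto simp: dual_actions fun_eq_iff lsc_eq_rsc)
  qed
qed


section \<open>Isometric copies\<close>

lemma cbanach_space_isometric:
  assumes "cbanach_space X"
    and bij: "bij_betw \<phi> (carrier X) (carrier Y)"
    and zero: "\<phi> \<zero>\<^bsub>X\<^esub> = \<zero>\<^bsub>Y\<^esub>"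
    and add: "\<And>x y. \<lbrakk>x \<in> carrier X; y \<in> carrier X\<rbrakk> \<Longrightarrow> \<phi> (x \<oplus>\<^bsub>X\<^esub> y) = \<phi> x \<oplus>\<^bsub>Y\<^esub> \<phi> y"
    and smult: "\<And>z x. x \<in> carrier X \<Longrightarrow> \<phi> (z \<odot>\<^bsub>X\<^esub> x) = z \<odot>\<^bsub>Y\<^esub> \<phi> x"
    and norm: "\<And>x. x \<in> carrier X \<Longrightarrow> vnorm Y (\<phi> x) = vnorm X x"
  shows "cbanach_space Y"
proof -
  interpret cbanach_space X by fact
  have img: "carrier Y = \<phi> ` carrier X"
    using bij by (simp add: bij_betw_def)
  have inj: "\<phi> x = \<phi> y \<longleftrightarrow> x = y" if "x \<in> carrier X" "y \<in> carrier X" for x y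
    using bij that by (auto simp: bij_betw_def inj_on_def)
  show ?thesis
  proof (rule cbanach_spaceI, unfold img)
    fix \<sigma> :: "nat \<Rightarrow> _"
    assume \<sigma>: "\<And>i. \<sigma> i \<in> \<phi> ` carrier X"
      and cauchy: "\<And>\<epsilon>. \<epsilon> > 0 \<Longrightarrow> \<exists>N. \<forall>i\<ge>N. \<forall>j\<ge>N. vnorm Y (\<sigma> i \<oplus>\<^bsub>Y\<^esub> (-1) \<odot>\<^bsub>Y\<^esub> \<sigma> j) < \<epsilon>"
    \<comment> \<open>The Cauchy sequence is pulled back to \<open>X\<close>, its limit found there
      and mapped forward by \<open>\<phi>\<close>.\<close>
    obtain \<tau> where \<tau>: "\<And>i. \<tau> i \<in> carrier X" "\<And>i. \<sigma> i = \<phi> (\<tau> i)"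
      using \<sigma> unfolding image_iff by metis
    have diff: "vnorm Y (\<sigma> i \<oplus>\<^bsub>Y\<^esub> (-1) \<odot>\<^bsub>Y\<^esub> \<phi> x) = vnorm X (\<tau> i \<ominus>\<^bsub>X\<^esub> x)" if "x \<in> carrier X" for i x
      using that \<tau>(1) by (simp add: \<tau>(2) smult[symmetric] add[symmetric] norm minus_eq_smult)
    obtain x where x: "x \<in> carrier X" and "(\<lambda>i. vnorm X (\<tau> i \<ominus>\<^bsub>X\<^esub> x)) \<longlonglongrightarrow> 0"
      using complete[of \<tau>] \<tau>(1) cauchy by (metis \<tau>(2) diff)
    then have "\<exists>N. \<forall>i\<ge>N. vnorm X (\<tau> i \<ominus>\<^bsub>X\<^esub> x) \<le> \<epsilon>" if "\<epsilon> > 0" for \<epsilon>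
      using that by (fastforce dest: LIMSEQ_D)
    then show "\<exists>x\<in>\<phi> ` carrier X. \<forall>\<epsilon>>0. \<exists>N. \<forall>i\<ge>N. vnorm Y (\<sigma> i \<oplus>\<^bsub>Y\<^esub> (-1) \<odot>\<^bsub>Y\<^esub> x) \<le> \<epsilon>"
      using x by (auto simp: diff)
  qed (auto simp: add[symmetric] smult[symmetric] zero[symmetric] norm inj a_assoc smult_add_left
        smult_add_right smult_smult vnorm_eq_0 vnorm_triangle vnorm_smult intro: a_comm)
qed

lemma banach_bimodule_isometric:
  assumes "banach_bimodule B X l r"
    and bij: "bij_betw \<phi> (carrier X) (carrier Y)"
    and zero: "\<phi> \<zero>\<^bsub>X\<^esub> = \<zero>\<^bsub>Y\<^esub>"
    and add: "\<And>x y. \<lbrakk>x \<in> carrier X; y \<in> carrier X\<rbrakk> \<Longrightarrow> \<phi> (x \<oplus>\<^bsub>X\<^esub> y) = \<phi> x \<oplus>\<^bsub>Y\<^esub> \<phi> y"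
    and smult: "\<And>z x. x \<in> carrier X \<Longrightarrow> \<phi> (z \<odot>\<^bsub>X\<^esub> x) = z \<odot>\<^bsub>Y\<^esub> \<phi> x"
    and norm: "\<And>x. x \<in> carrier X \<Longrightarrow> vnorm Y (\<phi> x) = vnorm X x"
    and l: "\<And>b x. \<lbrakk>b \<in> carrier B; x \<in> carrier X\<rbrakk> \<Longrightarrow> \<phi> (l b x) = l' b (\<phi> x)"
    and r: "\<And>b x. \<lbrakk>b \<in> carrier B; x \<in> carrier X\<rbrakk> \<Longrightarrow> \<phi> (r x b) = r' (\<phi> x) b"
  shows "banach_bimodule B Y l' r'"
proof -
  interpret banach_bimodule B X l r by fact
  have img: "carrier Y = \<phi> ` carrier X"
    using bij by (simp add: bij_betw_def)
  note [simp] = l_closed r_closed B.mult_closed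
  show ?thesis
  proof (intro banach_bimodule.intro banach_bimodule_axioms.intro)
    show "cbanach_algebra B" by unfold_locales
    show "cbanach_space Y"
      by (rule cbanach_space_isometric[OF X.cbanach_space_axioms bij zero add smult norm])
    show "\<exists>K. \<forall>b\<in>carrier B. \<forall>x\<in>carrier Y. vnorm Y (l' b x) \<le> K * vnorm B b * vnorm Y x"
      using l_bounded unfolding img by (auto simp: l[symmetric] norm)
    show "\<exists>K. \<forall>b\<in>carrier B. \<forall>x\<in>carrier Y. vnorm Y (r' x b) \<le> K * vnorm B b * vnorm Y x"
      using r_bounded unfolding img by (auto simp: r[symmetric] norm)
  qed (auto simp: img l[symmetric] r[symmetric] add[symmetric] smult[symmetric] l_add1 l_add2 r_add1 r_add2
      l_smult1 l_smult2 r_smult1 r_smult2 l_mult r_mult l_r)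
qed

text \<open>The map \<open>\<phi>\<close> is only known to intertwine the actions of elements of the
  carriers. The module algebra axioms keep \<open>scl A \<alpha> a\<close> and
  \<open>scr A a \<alpha>\<close> in \<open>carrier A\<close>, so the laws that mix both actions can
  be transferred too.\<close>

lemma commutative_banach_two_module_isometric:
  assumes "banach_module_algebra \<A> A" "commutative_banach_two_module \<A> A X"
    and iso: "isometric_iso \<A> A \<phi> X Y"
  shows "commutative_banach_two_module \<A> A Y"
proof -
  interpret alg: banach_module_algebra \<A> A by fact
  interpret commutative_banach_two_module \<A> A X by fact
  have img: "carrier Y = \<phi> ` carrier X"
    using iso by (simp add: isometric_iso_def bij_betw_def)
  have lact: "\<phi> (lact X a x) = lact Y a (\<phi> x)" and ract: "\<phi> (ract X x a) = ract Y (\<phi> x) a"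
    if "a \<in> carrier A" "x \<in> carrier X" for a x
    using iso that by (simp_all add: isometric_iso_def)
  have lsc: "\<phi> (lsc X \<alpha> x) = lsc Y \<alpha> (\<phi> x)" and rsc: "\<phi> (rsc X x \<alpha>) = rsc Y (\<phi> x) \<alpha>"
    if "\<alpha> \<in> carrier \<A>" "x \<in> carrier X" for \<alpha> x
    using iso that by (simp_all add: isometric_iso_def)
  note closed = AX.l_closed AX.r_closed CX.l_closed CX.r_closed alg.l_closed alg.r_closed
  show ?thesis
  proof (intro commutative_banach_two_module.intro banach_two_module.intro)
    show "banach_bimodule A Y (lact Y) (ract Y)"
      by (rule banach_bimodule_isometric[OF AX.banach_bimodule_axioms, of \<phi>])
        (use iso in \<open>simp_all add: isometric_iso_def\<close>)
    show "banach_bimodule \<A> Y (lsc Y) (rsc Y)"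
      by (rule banach_bimodule_isometric[OF CX.banach_bimodule_axioms, of \<phi>])
        (use iso in \<open>simp_all add: isometric_iso_def\<close>)
    show "banach_two_module_axioms \<A> A Y"
      by (intro banach_two_module_axioms.intro)
        (auto simp: img lact[symmetric] ract[symmetric] lsc[symmetric] rsc[symmetric] closed
          lsc_lact lsc_ract ract_scr lact_rsc lact_lsc ract_scl)
    show "commutative_banach_two_module_axioms \<A> Y"
      by (intro commutative_banach_two_module_axioms.intro)
        (auto simp: img lsc[symmetric] rsc[symmetric] lsc_eq_rsc)
  qed
qed

text \<open>The invariant carried through the successive duals. Commutativity of the module concerns
  the action of \<open>\<A>\<close>; the second conjunct, for \<open>A\<close> itself, makes
  \<open>a \<cdot> x - x \<cdot> a\<close> vanish, so that an inner derivation is zero.\<close>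

definition symmetric_two_module ::
    "('c, 'y) cnspace_scheme \<Rightarrow> ('c, 'a, 'z) module_alg_scheme \<Rightarrow> ('c, 'a, 'x) two_module \<Rightarrow> bool"
  where "symmetric_two_module \<A> A X \<longleftrightarrow> commutative_banach_two_module \<A> A X \<and>
    (\<forall>a\<in>carrier A. \<forall>x\<in>carrier X. lact X a x = ract X x a)"

lemma symmetric_two_module_dual:
  assumes "symmetric_two_module \<A> A X"
  shows "symmetric_two_module \<A> A (dual X)"
  using assms commutative_banach_two_module_dual[of \<A> A X]
  by (auto simp: symmetric_two_module_def dual_actions fun_eq_iff)

lemma symmetric_two_module_isometric:
  assumes "banach_module_algebra \<A> A" "symmetric_two_module \<A> A X" "isometric_iso \<A> A \<phi> X Y"
  shows "symmetric_two_module \<A> A Y"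
proof -
  have "lact Y a y = ract Y y a" if a: "a \<in> carrier A" and y: "y \<in> carrier Y" for a y
  proof -
    obtain x where x: "x \<in> carrier X" "y = \<phi> x"
      using assms(3) y unfolding isometric_iso_def bij_betw_def by blast
    then have "lact Y a y = \<phi> (lact X a x)" "ract Y y a = \<phi> (ract X x a)"
      using a assms(3) by (simp_all add: isometric_iso_def)
    then show ?thesis
      using assms(2) a x by (simp add: symmetric_two_module_def)
  qed
  then show ?thesis
    using assms commutative_banach_two_module_isometric[of \<A> A X \<phi> Y]
    by (simp add: symmetric_two_module_def)
qed

text \<open>Symmetry passes to duals and to isometric copies, and the \<open>n\<close>-th dual is
  built from exactly these two operations.\<close>

lemma symmetric_two_module_nth_dual:
  fixes X :: "('c, 'a, 'u) two_module"
  assumes A: "banach_module_algebra \<A> A" and M: "symmetric_two_module \<A> A M"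
    and X: "is_nth_dual \<A> A M n X"
  shows "symmetric_two_module \<A> A X"
  using X
proof (induction n arbitrary: X)
  case 0
  then show ?case
    using symmetric_two_module_isometric[OF A M] by auto
next
  case (Suc n)
  then obtain Y :: "('c, 'a, 'u) two_module" and \<phi>
    where Y: "is_nth_dual \<A> A M n Y" and \<phi>: "isometric_iso \<A> A \<phi> (dual Y) X"
    by auto
  show ?case
    by (rule symmetric_two_module_isometric[OF A symmetric_two_module_dual[OF Suc.IH[OF Y]] \<phi>])
qed


section \<open>Convolution on \<open>\<ell>\<^sup>1(S)\<close>\<close>

no_notation Infinite_Set_Sum.abs_summable_on (infix \<open>abs'_summable'_on\<close> 50)

text \<open>An absolutely convergent sum may be grouped along the fibres of any map
  \<open>g\<close>. Convolution is the case where \<open>g\<close> multiplies the two components of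
  a pair.\<close>

lemma infsum_fibres:
  fixes h :: "'p \<Rightarrow> 'b::banach" and g :: "'p \<Rightarrow> 'u"
  assumes h: "h abs_summable_on UNIV"
  shows "(\<lambda>u. infsum h {p. g p = u}) abs_summable_on UNIV"
    and "(\<Sum>\<^sub>\<infinity>u. infsum h {p. g p = u}) = infsum h UNIV"
    and "(\<Sum>\<^sub>\<infinity>u. norm (infsum h {p. g p = u})) \<le> (\<Sum>\<^sub>\<infinity>p. norm (h p))"
proof -
  let ?S = "Sigma UNIV (\<lambda>u. {p. g p = u})"
  \<comment> \<open>The disjoint union of the fibres is the whole index set, so Fubini for
    \<open>Sigma\<close> applies.\<close>
  have bij: "bij_betw snd ?S UNIV"
    by (rule bij_betw_byWitness[where f' = "\<lambda>p. (g p, p)"]) auto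
  have abs: "(\<lambda>x. norm (h (snd x))) summable_on ?S"
    using summable_on_reindex_bij_betw[OF bij, of "\<lambda>p. norm (h p)"] h by simp
  then have sum: "(\<lambda>x. h (snd x)) summable_on ?S"
    by (rule abs_summable_summable)
  have h': "h abs_summable_on {p. g p = u}" for u
    using h by (rule summable_on_subset_banach) simp
  have "(\<lambda>u. infsum (\<lambda>p. norm (h p)) {p. g p = u}) summable_on UNIV"
    using summable_on_Sigma_banach[of "\<lambda>u p. norm (h p)"] abs by (simp add: case_prod_unfold)
  then show *: "(\<lambda>u. infsum h {p. g p = u}) abs_summable_on UNIV"
    by (rule Infinite_Sum.abs_summable_on_comparison_test') (rule norm_infsum_bound[OF h'])
  show "(\<Sum>\<^sub>\<infinity>u. infsum h {p. g p = u}) = infsum h UNIV"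
    using infsum_Sigma_banach[OF sum] infsum_reindex_bij_betw[OF bij, of h] by simp
  have "(\<Sum>\<^sub>\<infinity>u. norm (infsum h {p. g p = u})) \<le> (\<Sum>\<^sub>\<infinity>u. infsum (\<lambda>p. norm (h p)) {p. g p = u})"
    by (rule infsum_mono[OF *]) (fact, rule norm_infsum_bound[OF h'])
  also have "\<dots> = (\<Sum>\<^sub>\<infinity>p. norm (h p))"
    using infsum_Sigma_banach[OF abs] infsum_reindex_bij_betw[OF bij, of "\<lambda>p. norm (h p)"] by simp
  finally show "(\<Sum>\<^sub>\<infinity>u. norm (infsum h {p. g p = u})) \<le> (\<Sum>\<^sub>\<infinity>p. norm (h p))" .
qed

lemma abs_summable_on_mult_pair:
  fixes f :: "'a \<Rightarrow> complex" and g :: "'b \<Rightarrow> complex"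
  assumes "f abs_summable_on UNIV" "g abs_summable_on UNIV"
  shows "(\<lambda>(s, t). f s * g t) abs_summable_on UNIV"
    and "(\<Sum>\<^sub>\<infinity>p. cmod (case p of (s, t) \<Rightarrow> f s * g t)) = (\<Sum>\<^sub>\<infinity>s. cmod (f s)) * (\<Sum>\<^sub>\<infinity>t. cmod (g t))"
proof -
  have "(\<lambda>(s, t). f s * g t) abs_summable_on UNIV \<times> UNIV"
    unfolding Infinite_Sum.abs_summable_on_Sigma_iff using assms
    by (auto simp: norm_mult abs_mult infsum_cmult_right' intro: summable_on_cmult_left summable_on_cmult_right)
  then show *: "(\<lambda>(s, t). f s * g t) abs_summable_on UNIV" by simp
  show "(\<Sum>\<^sub>\<infinity>p. cmod (case p of (s, t) \<Rightarrow> f s * g t)) = (\<Sum>\<^sub>\<infinity>s. cmod (f s)) * (\<Sum>\<^sub>\<infinity>t. cmod (g t))"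
    using infsum_Sigma_banach[of "\<lambda>p. cmod (case p of (s, t) \<Rightarrow> f s * g t)" UNIV "\<lambda>_. UNIV"] *
    by (simp add: norm_mult infsum_cmult_right' infsum_cmult_left')
qed

lemma conv_eq: "conv f g u = infsum (\<lambda>(s, t). f s * g t) {p. fst p * snd p = u}"
  by (simp add: conv_def case_prod_unfold)

lemma
  fixes f g :: "'s::semigroup_mult \<Rightarrow> complex"
  assumes "f abs_summable_on UNIV" "g abs_summable_on UNIV"
  shows abs_summable_on_conv: "conv f g abs_summable_on UNIV"
    and infsum_norm_conv_le: "(\<Sum>\<^sub>\<infinity>u. cmod (conv f g u)) \<le> (\<Sum>\<^sub>\<infinity>s. cmod (f s)) * (\<Sum>\<^sub>\<infinity>t. cmod (g t))"
  using infsum_fibres(1,3)[OF abs_summable_on_mult_pair(1)[OF assms], of "\<lambda>p. fst p * snd p"]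
  unfolding conv_eq abs_summable_on_mult_pair(2)[OF assms] by simp_all

lemma conv_summable:
  fixes f g :: "'s::semigroup_mult \<Rightarrow> complex"
  assumes "f abs_summable_on UNIV" "g abs_summable_on UNIV"
  shows "(\<lambda>(s, t). f s * g t) summable_on A"
  using abs_summable_summable[OF abs_summable_on_mult_pair(1)[OF assms]]
  by (rule summable_on_subset_banach) simp

lemma conv_add_left:
  fixes f g h :: "'s::semigroup_mult \<Rightarrow> complex"
  assumes "f abs_summable_on UNIV" "g abs_summable_on UNIV" "h abs_summable_on UNIV"
  shows "conv (\<lambda>s. f s + g s) h = (\<lambda>u. conv f h u + conv g h u)"
  unfolding conv_eq using infsum_add[OF conv_summable[OF assms(1,3)] conv_summable[OF assms(2,3)]]
  by (simp add: case_prod_unfold distrib_right)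

lemma conv_smult_left: "conv (\<lambda>s. z * f s) h = (\<lambda>u. z * conv f h u)"
  unfolding conv_eq by (simp add: case_prod_unfold infsum_cmult_right'[symmetric] mult.assoc)

lemma conv_commute:
  fixes f g :: "'s::ab_semigroup_mult \<Rightarrow> complex"
  shows "conv f g = conv g f"
proof
  fix u
  \<comment> \<open>In a commutative semigroup, exchanging the factors maps each fibre of the
    multiplication onto itself.\<close>
  have "bij_betw prod.swap {p. fst p * snd p = u} {p :: 's \<times> 's. fst p * snd p = u}"
    by (rule bij_betw_byWitness[where f' = prod.swap]) (auto simp: mult.commute)
  from infsum_reindex_bij_betw[OF this, of "\<lambda>(s, t). f s * g t"]
  show "conv f g u = conv g f u"
    by (simp add: conv_eq case_prod_unfold mult.commute)
qed

lemma conv_add_right: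
  fixes f g h :: "'s::ab_semigroup_mult \<Rightarrow> complex"
  assumes "f abs_summable_on UNIV" "g abs_summable_on UNIV" "h abs_summable_on UNIV"
  shows "conv h (\<lambda>s. f s + g s) = (\<lambda>u. conv h f u + conv h g u)"
  using conv_add_left[OF assms] by (simp only: conv_commute)

lemma conv_smult_right:
  fixes f h :: "'s::ab_semigroup_mult \<Rightarrow> complex"
  shows "conv h (\<lambda>s. z * f s) = (\<lambda>u. z * conv h f u)"
  using conv_smult_left[of z f h] by (simp only: conv_commute)

text \<open>On the fibre over \<open>u\<close> the factor \<phi>(u) equals \<phi>(s * t), so it can
  be moved inside the convolution sum. Boundedness of \<phi> makes the resulting double sum
  absolutely convergent, which permits regrouping over pairs and exchanging the order of
  summation.\<close>

lemma infsum_mult_conv: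
  fixes f g \<phi> :: "'s::semigroup_mult \<Rightarrow> complex"
  assumes f: "f abs_summable_on UNIV" and g: "g abs_summable_on UNIV" and \<phi>: "\<And>u. cmod (\<phi> u) \<le> B"
  shows "(\<Sum>\<^sub>\<infinity>u. \<phi> u * conv f g u) = (\<Sum>\<^sub>\<infinity>t. (\<Sum>\<^sub>\<infinity>s. \<phi> (s * t) * f s) * g t)"
proof -
  let ?h = "\<lambda>(s, t). \<phi> (s * t) * (f s * g t)"
  have abs: "?h abs_summable_on UNIV"
  proof (rule Infinite_Sum.abs_summable_on_comparison_test')
    show "(\<lambda>p. B * cmod (case p of (s, t) \<Rightarrow> f s * g t)) summable_on UNIV"
      by (rule summable_on_cmult_right[OF abs_summable_on_mult_pair(1)[OF f g]])
    show "cmod (?h p) \<le> B * cmod (case p of (s, t) \<Rightarrow> f s * g t)" for p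
      using \<phi> by (auto simp: norm_mult intro!: mult_right_mono split: prod.split)
  qed
  have "(\<Sum>\<^sub>\<infinity>u. \<phi> u * conv f g u) = (\<Sum>\<^sub>\<infinity>u. infsum ?h {p. fst p * snd p = u})"
    unfolding conv_eq infsum_cmult_right'[symmetric]
    by (intro infsum_cong) (auto simp: case_prod_unfold intro: infsum_cong)
  also have "\<dots> = infsum ?h UNIV"
    by (rule infsum_fibres(2)[OF abs])
  also have "\<dots> = (\<Sum>\<^sub>\<infinity>s. \<Sum>\<^sub>\<infinity>t. \<phi> (s * t) * (f s * g t))"
    using infsum_Sigma_banach[of ?h UNIV "\<lambda>_. UNIV"] abs_summable_summable[OF abs] by simp
  also have "\<dots> = (\<Sum>\<^sub>\<infinity>t. \<Sum>\<^sub>\<infinity>s. \<phi> (s * t) * (f s * g t))"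
    using abs_summable_summable[OF abs] by (intro infsum_swap_banach) simp
  also have "\<dots> = (\<Sum>\<^sub>\<infinity>t. (\<Sum>\<^sub>\<infinity>s. \<phi> (s * t) * f s) * g t)"
    by (simp add: infsum_cmult_left'[symmetric] mult.assoc)
  finally show ?thesis .
qed

text \<open>
  Paired with a bounded function of \<open>u\<close>, both threefold convolutions turn into the same iterated
  sum; the pairing with a point mass at \<open>u\<close> recovers the value there.
\<close>

lemma conv_assoc:
  fixes f g h :: "'s::semigroup_mult \<Rightarrow> complex"
  assumes f: "f abs_summable_on UNIV" and g: "g abs_summable_on UNIV" and h: "h abs_summable_on UNIV"
  shows "conv (conv f g) h = conv f (conv g h)"
proof
  fix u
  define \<phi> :: "'s \<Rightarrow> complex" where "\<phi> v = (if v = u then 1 else 0)" for v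
  have \<phi>: "cmod (\<phi> v) \<le> 1" for v by (simp add: \<phi>_def)
  have eval: "(\<Sum>\<^sub>\<infinity>v. \<phi> v * k v) = k u" for k
  proof -
    have "(\<Sum>\<^sub>\<infinity>v. \<phi> v * k v) = infsum k {u}"
      by (rule infsum_cong_neutral) (auto simp: \<phi>_def)
    then show ?thesis by simp
  qed
  \<comment> \<open>The inner sum is itself a bounded function of \<open>t\<close>, so it can serve
    as the bounded weight in \<open>infsum_mult_conv\<close> for \<open>conv g h\<close>.\<close>
  have bound: "cmod (\<Sum>\<^sub>\<infinity>s. \<phi> (s * t) * f s) \<le> (\<Sum>\<^sub>\<infinity>s. cmod (f s))" for t
  proof -
    have le: "cmod (\<phi> (s * t) * f s) \<le> cmod (f s)" for s by (simp add: \<phi>_def)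
    then have abs: "(\<lambda>s. \<phi> (s * t) * f s) abs_summable_on UNIV"
      using f by (intro Infinite_Sum.abs_summable_on_comparison_test'[OF f])
    show ?thesis
      using norm_infsum_bound[OF abs] infsum_mono[OF abs f le] by linarith
  qed
  have "conv (conv f g) h u = (\<Sum>\<^sub>\<infinity>c. (\<Sum>\<^sub>\<infinity>v. \<phi> (v * c) * conv f g v) * h c)"
    using infsum_mult_conv[where \<phi> = \<phi>, OF abs_summable_on_conv[OF f g] h \<phi>] by (simp add: eval)
  also have "\<dots> = (\<Sum>\<^sub>\<infinity>c. (\<Sum>\<^sub>\<infinity>b. (\<Sum>\<^sub>\<infinity>s. \<phi> (s * b * c) * f s) * g b) * h c)"
    by (simp only: infsum_mult_conv[where \<phi> = "\<lambda>v. \<phi> (v * c)" for c, OF f g \<phi>])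
  \<comment> \<open>Associativity of the semigroup enters here.\<close>
  also have "\<dots> = (\<Sum>\<^sub>\<infinity>c. (\<Sum>\<^sub>\<infinity>b. (\<Sum>\<^sub>\<infinity>s. \<phi> (s * (b * c)) * f s) * g b) * h c)"
    by (simp add: mult.assoc)
  also have "\<dots> = (\<Sum>\<^sub>\<infinity>v. (\<Sum>\<^sub>\<infinity>s. \<phi> (s * v) * f s) * conv g h v)"
    by (rule infsum_mult_conv[where \<phi> = "\<lambda>v. \<Sum>\<^sub>\<infinity>s. \<phi> (s * v) * f s", OF g h bound, symmetric])
  also have "\<dots> = conv f (conv g h) u"
    using infsum_mult_conv[where \<phi> = \<phi>, OF f abs_summable_on_conv[OF g h] \<phi>] by (simp add: eval)
  finally show "conv (conv f g) h u = conv f (conv g h) u" .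
qed

lemma conv_support:
  assumes "\<And>s t. \<lbrakk>s \<in> T; t \<in> T\<rbrakk> \<Longrightarrow> s * t \<in> T"
    and "\<And>s. s \<notin> T \<Longrightarrow> f s = 0" "\<And>s. s \<notin> T \<Longrightarrow> g s = 0" "u \<notin> T"
  shows "conv f g u = 0"
  unfolding conv_def by (rule infsum_0) (use assms in fastforce)

text \<open>Leaving the extension \<open>m\<close> arbitrary lets one proof of the Banach space and
  algebra laws serve \<open>ell1 T\<close> itself and the records that add actions to it.\<close>

lemma ell1_extend_simps [simp]:
  "carrier (cnspace.extend (ell1 T) m) = {f. (\<forall>s. s \<notin> T \<longrightarrow> f s = 0) \<and> f abs_summable_on UNIV}"
  "mult (cnspace.extend (ell1 T) m) = conv"
  "zero (cnspace.extend (ell1 T) m) = (\<lambda>s. 0)"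
  "add (cnspace.extend (ell1 T) m) = (\<lambda>f g s. f s + g s)"
  "smult (cnspace.extend (ell1 T) m) = (\<lambda>z f s. z * f s)"
  "vnorm (cnspace.extend (ell1 T) m) = (\<lambda>f. \<Sum>\<^sub>\<infinity>s. cmod (f s))"
  by (simp_all add: ell1_def cnspace.defs)

section \<open>Norm, completeness and algebra structure of the summable functions\<close>

lemma infsum_norm_eq_0_iff:
  fixes f :: "'s \<Rightarrow> complex"
  assumes "f abs_summable_on UNIV"
  shows "(\<Sum>\<^sub>\<infinity>s. cmod (f s)) = 0 \<longleftrightarrow> f = (\<lambda>s. 0)"
proof
  assume 0: "(\<Sum>\<^sub>\<infinity>s. cmod (f s)) = 0"
  show "f = (\<lambda>s. 0)"
  proof
    fix s
    show "f s = 0"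
      using finite_sum_le_infsum[OF assms, of "{s}"] 0 by simp
  qed
qed simp

lemma abs_summable_on_add_norm_le:
  fixes f g :: "'s \<Rightarrow> complex"
  assumes "f abs_summable_on UNIV" "g abs_summable_on UNIV"
  shows "(\<lambda>s. f s + g s) abs_summable_on UNIV"
    and "(\<Sum>\<^sub>\<infinity>s. cmod (f s + g s)) \<le> (\<Sum>\<^sub>\<infinity>s. cmod (f s)) + (\<Sum>\<^sub>\<infinity>s. cmod (g s))"
proof -
  have *: "(\<lambda>s. cmod (f s) + cmod (g s)) summable_on UNIV"
    using assms by (rule summable_on_add)
  then show sum: "(\<lambda>s. f s + g s) abs_summable_on UNIV"
    by (rule Infinite_Sum.abs_summable_on_comparison_test') (rule norm_triangle_ineq)
  show "(\<Sum>\<^sub>\<infinity>s. cmod (f s + g s)) \<le> (\<Sum>\<^sub>\<infinity>s. cmod (f s)) + (\<Sum>\<^sub>\<infinity>s. cmod (g s))"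
    using infsum_mono[OF sum * norm_triangle_ineq] infsum_add[OF assms] by simp
qed

lemma abs_summable_on_smult:
  fixes f :: "'s \<Rightarrow> complex"
  assumes "f abs_summable_on UNIV"
  shows "(\<lambda>s. z * f s) abs_summable_on UNIV"
  using assms by (simp add: norm_mult summable_on_cmult_right)

text \<open>The limit is taken pointwise. A Fatou type argument follows: estimates on finite partial
  sums pass to the limit, and they bound the infinite sum because they do not depend on the finite
  set.\<close>

lemma ell1_limit:
  fixes \<sigma> :: "nat \<Rightarrow> 's \<Rightarrow> complex"
  assumes \<sigma>: "\<And>i. \<sigma> i abs_summable_on UNIV"
    and cauchy: "\<And>\<epsilon>. \<epsilon> > 0 \<Longrightarrow> \<exists>N. \<forall>i\<ge>N. \<forall>j\<ge>N. (\<Sum>\<^sub>\<infinity>s. cmod (\<sigma> i s - \<sigma> j s)) < \<epsilon>"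
  obtains f where "f abs_summable_on UNIV" "\<And>s. (\<lambda>i. \<sigma> i s) \<longlonglongrightarrow> f s"
    "\<And>\<epsilon>. \<epsilon> > 0 \<Longrightarrow> \<exists>N. \<forall>i\<ge>N. (\<Sum>\<^sub>\<infinity>s. cmod (\<sigma> i s - f s)) \<le> \<epsilon>"
proof -
  have diff: "(\<lambda>s. \<sigma> i s - \<sigma> j s) abs_summable_on UNIV" for i j
    using abs_summable_on_add_norm_le(1)[OF \<sigma> abs_summable_on_smult[OF \<sigma>], of i "-1" j] by simp
  have fin: "(\<Sum>s\<in>F. cmod (\<sigma> i s - \<sigma> j s)) \<le> (\<Sum>\<^sub>\<infinity>s. cmod (\<sigma> i s - \<sigma> j s))" if "finite F" for F i j
    using finite_sum_le_infsum[OF diff that] by simp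
  have "convergent (\<lambda>i. \<sigma> i s)" for s
  proof (rule Cauchy_convergent, rule metric_CauchyI)
    fix e :: real assume "e > 0"
    then show "\<exists>M. \<forall>m\<ge>M. \<forall>n\<ge>M. dist (\<sigma> m s) (\<sigma> n s) < e"
      using cauchy[of e] fin[of "{s}"] by (simp add: dist_norm) (meson le_less_trans)
  qed
  then obtain f where lim: "\<And>s. (\<lambda>i. \<sigma> i s) \<longlonglongrightarrow> f s"
    unfolding convergent_def by metis
  \<comment> \<open>The index \<open>N\<close> is chosen before the finite set \<open>F\<close>;
    this uniformity later allows the supremum over all \<open>F\<close>.\<close>
  have close: "\<exists>N. \<forall>i\<ge>N. \<forall>F. finite F \<longrightarrow> (\<Sum>s\<in>F. cmod (\<sigma> i s - f s)) \<le> \<epsilon>" if pos: "\<epsilon> > 0" for \<epsilon>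
  proof -
    obtain N where N: "\<And>i j. i \<ge> N \<Longrightarrow> j \<ge> N \<Longrightarrow> (\<Sum>\<^sub>\<infinity>s. cmod (\<sigma> i s - \<sigma> j s)) < \<epsilon>"
      using cauchy[OF pos] by blast
    have "(\<Sum>s\<in>F. cmod (\<sigma> i s - f s)) \<le> \<epsilon>" if "i \<ge> N" "finite F" for i F
    proof (rule Lim_bounded)
      show "(\<lambda>j. \<Sum>s\<in>F. cmod (\<sigma> i s - \<sigma> j s)) \<longlonglongrightarrow> (\<Sum>s\<in>F. cmod (\<sigma> i s - f s))"
        by (intro tendsto_intros lim)
      show "\<forall>j\<ge>N. (\<Sum>s\<in>F. cmod (\<sigma> i s - \<sigma> j s)) \<le> \<epsilon>"
        using N[OF that(1)] fin[OF that(2)] by (meson le_less_trans less_imp_le)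
    qed
    then show ?thesis by blast
  qed
  have sum: "(\<lambda>s. \<sigma> i s - f s) abs_summable_on UNIV"
    if "\<forall>F. finite F \<longrightarrow> (\<Sum>s\<in>F. cmod (\<sigma> i s - f s)) \<le> \<epsilon>" for i \<epsilon>
    using that by (intro nonneg_bdd_above_summable_on bdd_aboveI2[where M = \<epsilon>]) auto
  obtain N where "\<forall>F. finite F \<longrightarrow> (\<Sum>s\<in>F. cmod (\<sigma> N s - f s)) \<le> 1"
    using close[of 1] by auto
  \<comment> \<open>Here \<open>f\<close> is recovered as \<sigma>(N) minus the summable difference
    of \<sigma>(N) and \<open>f\<close>.\<close>
  then have "f abs_summable_on UNIV"
    using abs_summable_on_add_norm_le(1)[OF \<sigma> abs_summable_on_smult[OF sum], of N 1 N "-1"] by simp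
  moreover have "\<exists>N. \<forall>i\<ge>N. (\<Sum>\<^sub>\<infinity>s. cmod (\<sigma> i s - f s)) \<le> \<epsilon>" if "\<epsilon> > 0" for \<epsilon>
    using close[OF that] infsum_le_finite_sums[OF sum, of _ \<epsilon> \<epsilon>] by blast
  ultimately show thesis using that lim by blast
qed

lemma cbanach_space_ell1: "cbanach_space (cnspace.extend (ell1 T) m)"
proof (rule cbanach_spaceI, goal_cases)
  case (15 \<sigma>)
  obtain f where f: "f abs_summable_on UNIV" "\<And>s. (\<lambda>i. \<sigma> i s) \<longlonglongrightarrow> f s"
    "\<And>\<epsilon>. \<epsilon> > 0 \<Longrightarrow> \<exists>N. \<forall>i\<ge>N. (\<Sum>\<^sub>\<infinity>s. cmod (\<sigma> i s - f s)) \<le> \<epsilon>"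
    by (rule ell1_limit[of \<sigma>]) (use 15 in auto)
  \<comment> \<open>Vanishing outside \<open>T\<close> is a pointwise condition and hence survives
    the limit.\<close>
  have "f s = 0" if "s \<notin> T" for s
    using f(2)[of s] 15(1) that by (simp add: LIMSEQ_const_iff)
  with f(1,3) show ?case by (intro bexI[of _ f]) auto
qed (auto simp: infsum_norm_eq_0_iff abs_summable_on_add_norm_le abs_summable_on_smult norm_mult
    infsum_cmult_right' summable_on_cmult_right algebra_simps)

lemma cbanach_algebra_ell1:
  fixes T :: "'s::ab_semigroup_mult set"
  assumes "\<And>s t. \<lbrakk>s \<in> T; t \<in> T\<rbrakk> \<Longrightarrow> s * t \<in> T"
  shows "cbanach_algebra (cnspace.extend (ell1 T) m)"
proof (intro cbanach_algebra.intro cbanach_space_ell1 cbanach_algebra_axioms.intro)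
qed (auto simp: abs_summable_on_conv infsum_norm_conv_le conv_add_left conv_add_right conv_smult_left
    conv_smult_right conv_assoc conv_support[OF assms])


section \<open>The module \<open>\<ell>\<^sup>1(S)\<close> over \<open>\<ell>\<^sup>1(E)\<close>\<close>

lemma star_eqI:
  fixes s :: "'s::inverse_semigroup"
  assumes "s * t * s = s" "t * s * t = t"
  shows "star s = t"
  unfolding star_def by (rule the1_equality[OF ex1_inverse]) (use assms in simp)

lemma star_inverse:
  fixes s :: "'s::inverse_semigroup"
  shows "s * star s * s = s" "star s * s * star s = star s"
  using theI'[OF ex1_inverse[of s]] by (simp_all add: star_def)

text \<open>If \<open>e * e = e\<close> then \<open>e\<close> satisfies both equations of an inverse
  of \<open>e\<close>, and uniqueness gives \<open>star e = e\<close>.\<close>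

lemma idempotents_iff: "e \<in> idempotents \<longleftrightarrow> e * e = e"
  by (auto simp: idempotents_def star_eqI[symmetric])

lemma idempotents_mult_closed:
  fixes e f :: "'s::{inverse_semigroup, ab_semigroup_mult}"
  assumes "e \<in> idempotents" "f \<in> idempotents"
  shows "e * f \<in> idempotents"
proof -
  have "(e * f) * (e * f) = (e * e) * (f * f)" by (simp add: mult_ac)
  then show ?thesis using assms by (simp add: idempotents_iff)
qed

lemma mult_star_in_idempotents:
  fixes s :: "'s::inverse_semigroup"
  shows "s * star s \<in> idempotents"
  by (simp add: idempotents_iff mult.assoc[symmetric] star_inverse)

lemma conv_left_commute:
  fixes f g h :: "'s::ab_semigroup_mult \<Rightarrow> complex"
  assumes "f abs_summable_on UNIV" "g abs_summable_on UNIV" "h abs_summable_on UNIV"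
  shows "conv f (conv g h) = conv g (conv f h)"
  using assms by (metis conv_assoc conv_commute)

lemma ell1_simps [simp]:
  "carrier (ell1 T) = {f. (\<forall>s. s \<notin> T \<longrightarrow> f s = 0) \<and> f abs_summable_on UNIV}"
  "mult (ell1 T) = conv"
  "zero (ell1 T) = (\<lambda>s. 0)"
  "add (ell1 T) = (\<lambda>f g s. f s + g s)"
  "smult (ell1 T) = (\<lambda>z f s. z * f s)"
  "vnorm (ell1 T) = (\<lambda>f. \<Sum>\<^sub>\<infinity>s. cmod (f s))"
  by (simp_all add: ell1_def)

lemma ell1_module_simps [simp]:
  "carrier ell1_module = {f. f abs_summable_on UNIV}"
  "mult ell1_module = conv"
  "zero ell1_module = (\<lambda>s. 0)"
  "add ell1_module = (\<lambda>f g s. f s + g s)"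
  "smult ell1_module = (\<lambda>z f s. z * f s)"
  "vnorm ell1_module = (\<lambda>f. \<Sum>\<^sub>\<infinity>s. cmod (f s))"
  "scl ell1_module = (\<lambda>\<alpha> a. conv a \<alpha>)"
  "scr ell1_module = (\<lambda>a \<alpha>. conv a \<alpha>)"
  unfolding ell1_module_def ell1_extend_simps by (simp_all add: cnspace.defs module_alg.defs)

text \<open>A model of the quotient by the zero ideal whose elements are functions instead of
  singleton cosets; it is the starting point for the duals. Commutativity of convolution allows
  \<open>conv\<close> to be used for all four actions.\<close>

definition ell1_two_module ::
    "('s::semigroup_mult \<Rightarrow> complex, 's \<Rightarrow> complex, 's \<Rightarrow> complex) two_module"
  where "ell1_two_module =
    cnspace.extend (ell1 UNIV) (two_module.fields conv conv conv conv)"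

lemma ell1_two_module_simps [simp]:
  "carrier ell1_two_module = {f. f abs_summable_on UNIV}"
  "zero ell1_two_module = (\<lambda>s. 0)"
  "add ell1_two_module = (\<lambda>f g s. f s + g s)"
  "smult ell1_two_module = (\<lambda>z f s. z * f s)"
  "vnorm ell1_two_module = (\<lambda>f. \<Sum>\<^sub>\<infinity>s. cmod (f s))"
  "lact ell1_two_module = conv" "ract ell1_two_module = conv"
  "lsc ell1_two_module = conv" "rsc ell1_two_module = conv"
  unfolding ell1_two_module_def ell1_extend_simps by (simp_all add: cnspace.defs two_module.defs)

lemma cbanach_algebra_ell1_idempotents:
  "cbanach_algebra (ell1 (idempotents :: 's::{inverse_semigroup, ab_semigroup_mult} set))"
proof -
  have "ell1 T = cnspace.extend (ell1 T) ()" for T :: "'s set"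
    by (simp add: ell1_def cnspace.defs)
  then show ?thesis
    using cbanach_algebra_ell1[OF idempotents_mult_closed] by metis
qed

lemma cbanach_algebra_ell1_module:
  "cbanach_algebra (ell1_module :: ('s::{inverse_semigroup, ab_semigroup_mult} \<Rightarrow> complex, _) module_alg)"
  unfolding ell1_module_def by (rule cbanach_algebra_ell1) simp

text \<open>Covers the action of the idempotent algebra as well as that of the full algebra on
  itself. The equations for \<open>l\<close> and \<open>r\<close> let an action with swapped
  arguments, such as \<open>scl ell1_module\<close>, be matched by commutativity.\<close>

lemma banach_bimodule_ell1:
  fixes B :: "('s::ab_semigroup_mult \<Rightarrow> complex, 'y) cnspace_scheme"
    and X :: "('s \<Rightarrow> complex, 'z) cnspace_scheme"
  assumes "cbanach_algebra B" "cbanach_space X"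
    and B: "carrier B \<subseteq> {f. f abs_summable_on UNIV}" "mult B = conv" "add B = (\<lambda>f g s. f s + g s)"
      "smult B = (\<lambda>z f s. z * f s)" "vnorm B = (\<lambda>f. \<Sum>\<^sub>\<infinity>s. cmod (f s))"
    and X: "carrier X = {f. f abs_summable_on UNIV}" "add X = (\<lambda>f g s. f s + g s)"
      "smult X = (\<lambda>z f s. z * f s)" "vnorm X = (\<lambda>f. \<Sum>\<^sub>\<infinity>s. cmod (f s))"
    and l: "l = conv" and r: "r = conv"
  shows "banach_bimodule B X l r"
proof (intro banach_bimodule.intro assms(1,2) banach_bimodule_axioms.intro)
  have "\<forall>b\<in>carrier B. \<forall>x\<in>carrier X. vnorm X (conv b x) \<le> 1 * vnorm B b * vnorm X x"
    using B(1) by (auto simp: B X subset_iff intro!: infsum_norm_conv_le)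
  then show "\<exists>K. \<forall>b\<in>carrier B. \<forall>x\<in>carrier X. vnorm X (l b x) \<le> K * vnorm B b * vnorm X x"
    "\<exists>K. \<forall>b\<in>carrier B. \<forall>x\<in>carrier X. vnorm X (r x b) \<le> K * vnorm B b * vnorm X x"
    unfolding l r by (metis, metis conv_commute)
qed (use B(1) in \<open>auto simp: B X l r subset_iff abs_summable_on_conv conv_add_left conv_add_right
    conv_smult_left conv_smult_right conv_assoc conv_commute conv_left_commute\<close>)

lemma banach_module_algebra_ell1:
  "banach_module_algebra (ell1 idempotents)
    (ell1_module :: ('s::{inverse_semigroup, ab_semigroup_mult} \<Rightarrow> complex, 's \<Rightarrow> complex) module_alg)"
proof (intro banach_module_algebra.intro cbanach_algebra_ell1_module banach_module_algebra_axioms.intro)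
  show "banach_bimodule (ell1 idempotents)
    (ell1_module :: ('s::{inverse_semigroup, ab_semigroup_mult} \<Rightarrow> complex, 's \<Rightarrow> complex) module_alg)
    (scl ell1_module) (scr ell1_module)"
    by (rule banach_bimodule_ell1[OF cbanach_algebra_ell1_idempotents
          cbanach_algebra.axioms(1)[OF cbanach_algebra_ell1_module]])
      (auto simp: conv_commute)
qed (auto simp: conv_assoc conv_commute conv_left_commute)

lemma symmetric_two_module_ell1:
  "symmetric_two_module (ell1 idempotents)
    (ell1_module :: ('s::{inverse_semigroup, ab_semigroup_mult} \<Rightarrow> complex, 's \<Rightarrow> complex) module_alg)
    ell1_two_module"
  unfolding symmetric_two_module_def
proof (intro conjI commutative_banach_two_module.intro banach_two_module.intro)
  have space: "cbanach_space (ell1_two_module :: ('s \<Rightarrow> complex, 's \<Rightarrow> complex, 's \<Rightarrow> complex) two_module)"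
    unfolding ell1_two_module_def by (rule cbanach_space_ell1)
  show "banach_bimodule (ell1_module :: ('s \<Rightarrow> complex, 's \<Rightarrow> complex) module_alg)
      (ell1_two_module :: ('s \<Rightarrow> complex, 's \<Rightarrow> complex, 's \<Rightarrow> complex) two_module)
      (lact ell1_two_module) (ract ell1_two_module)"
    by (rule banach_bimodule_ell1[OF cbanach_algebra_ell1_module space]) auto
  show "banach_bimodule (ell1 (idempotents :: 's set))
      (ell1_two_module :: ('s \<Rightarrow> complex, 's \<Rightarrow> complex, 's \<Rightarrow> complex) two_module)
      (lsc ell1_two_module) (rsc ell1_two_module)"
    by (rule banach_bimodule_ell1[OF cbanach_algebra_ell1_idempotents space]) auto
  show "banach_two_module_axioms (ell1 (idempotents :: 's set))
      (ell1_module :: ('s \<Rightarrow> complex, 's \<Rightarrow> complex) module_alg) ell1_two_module"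
    by (intro banach_two_module_axioms.intro) (auto simp: conv_assoc conv_commute conv_left_commute)
  show "commutative_banach_two_module_axioms (ell1 (idempotents :: 's set))
      (ell1_two_module :: ('s \<Rightarrow> complex, 's \<Rightarrow> complex, 's \<Rightarrow> complex) two_module)"
    by (intro commutative_banach_two_module_axioms.intro) (auto simp: conv_commute)
qed (simp add: conv_commute)

section \<open>The ideal \<open>J\<close> is zero and the quotient is the algebra itself\<close>

lemma closed_ideal_zero:
  fixes A (structure)
  assumes "cbanach_algebra A"
  shows "closed_ideal A {\<zero>\<^bsub>A\<^esub>}"
proof -
  interpret cbanach_algebra A by fact
  have "submodule {\<zero>} complex_scalars A"
    by (rule submoduleI) auto
  \<comment> \<open>Writing zero as the scalar 0 times itself and moving the scalar out of the
    product.\<close>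
  moreover have "a \<otimes> \<zero> = \<zero>" "\<zero> \<otimes> a = \<zero>" if "a \<in> carrier A" for a
    using mult_smult_right[of a \<zero> 0] mult_smult_left[of \<zero> a 0] that by (simp_all add: mult_closed)
  \<comment> \<open>The sequence is constantly zero, so the norms form the constant sequence
    \<open>vnorm A x\<close>; its limit 0 forces \<open>x = \<zero>\<close>.\<close>
  moreover have "x = \<zero>" if "\<forall>i::nat. \<sigma> i \<in> {\<zero>}" "x \<in> carrier A" "(\<lambda>i. vnorm A (\<sigma> i \<ominus> x)) \<longlonglongrightarrow> 0" for \<sigma> x
    using that by (simp add: minus_eq_smult vnorm_smult LIMSEQ_const_iff vnorm_eq_0)
  ultimately show ?thesis
    by (auto simp: closed_ideal_def)
qed

text \<open>All generators vanish, so \<open>{\<zero>}\<close> is among the closed ideals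
  intersected; conversely every ideal contains zero.\<close>

lemma module_ideal_eq_zero:
  assumes "banach_module_algebra \<A> A"
    and eq: "\<And>a b \<alpha>. \<lbrakk>a \<in> carrier A; b \<in> carrier A; \<alpha> \<in> carrier \<A>\<rbrakk>
      \<Longrightarrow> scr A a \<alpha> \<otimes>\<^bsub>A\<^esub> b = a \<otimes>\<^bsub>A\<^esub> scl A \<alpha> b"
  shows "module_ideal \<A> A = {\<zero>\<^bsub>A\<^esub>}"
proof -
  interpret banach_module_algebra \<A> A by fact
  have "\<zero>\<^bsub>A\<^esub> \<in> I" if "closed_ideal A I" for I
    using that A.submoduleE(2,4)[of I] by (metis (no_types, lifting) A.smult_0_left A.submoduleE(1)
        UNIV_I closed_ideal_def complex_scalars_simps(1) equals0I subsetD)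
  moreover have "(scr A a \<alpha> \<otimes>\<^bsub>A\<^esub> b) \<ominus>\<^bsub>A\<^esub> (a \<otimes>\<^bsub>A\<^esub> scl A \<alpha> b) \<in> {\<zero>\<^bsub>A\<^esub>}"
    if "a \<in> carrier A" "b \<in> carrier A" "\<alpha> \<in> carrier \<A>" for a b \<alpha>
    using that by (simp add: eq a_minus_def A.mult_closed l_closed A.r_neg)
  ultimately show ?thesis
    using closed_ideal_zero[OF A.cbanach_algebra_axioms] unfolding module_ideal_def by blast
qed

text \<open>Modulo the zero ideal the coset of \<open>x\<close> is \<open>{x}\<close>, and both the
  infimum in the quotient norm and the unions in the operations range over a single element.\<close>

lemma isometric_iso_ell1_quotient:
  fixes \<A> :: "('s::{inverse_semigroup, ab_semigroup_mult} \<Rightarrow> complex, 'y) cnspace_scheme"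
  shows "isometric_iso \<A> ell1_module (\<lambda>x. {x}) ell1_two_module
    (quotient_module (ell1_module :: ('s \<Rightarrow> complex, 's \<Rightarrow> complex) module_alg) {\<lambda>s. 0})"
  by (auto simp: isometric_iso_def quotient_module_def A_RCOSETS_def' a_r_coset_def' set_add_def'
      bij_betw_def conv_commute)


section \<open>Module derivations vanish\<close>

lemma point_mass_abs_summable [simp]: "point_mass s abs_summable_on UNIV"
  and infsum_norm_point_mass [simp]: "(\<Sum>\<^sub>\<infinity>t. cmod (point_mass s t)) = 1"
proof -
  have "((\<lambda>t. cmod (point_mass s t)) has_sum 1) UNIV"
    by (rule has_sum_cong_neutral[THEN iffD1, OF _ _ _ has_sum_finite[of "{s}" "\<lambda>_. 1 :: real", simplified]])
      (auto simp: point_mass_def)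
  then show "point_mass s abs_summable_on UNIV" "(\<Sum>\<^sub>\<infinity>t. cmod (point_mass s t)) = 1"
    by (auto simp: summable_on_def infsumI)
qed

lemma module_derivation_point_mass:
  fixes X :: "('s::{inverse_semigroup, ab_semigroup_mult} \<Rightarrow> complex, 's \<Rightarrow> complex, 'u) two_module"
  assumes X: "symmetric_two_module (ell1 idempotents) ell1_module X"
    and D: "module_derivation (ell1 idempotents) ell1_module X D"
  shows "D (point_mass s) = \<zero>\<^bsub>X\<^esub>"
proof -
  interpret commutative_banach_two_module "ell1 idempotents" ell1_module X
    using X by (simp add: symmetric_two_module_def)
  \<comment> \<open>Only point masses act in this proof, so \<open>X\<close> is treated as a module
    over the semigroup.\<close>
  define act (infixr "\<bullet>" 75) where "s \<bullet> x = lact X (point_mass s) x" for s x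
  define d where "d s = D (point_mass s)" for s
  have d_in [simp]: "d s \<in> carrier X" for s
    using D by (simp add: module_derivation_def d_def)
  have act_in [simp]: "s \<bullet> x \<in> carrier X" if "x \<in> carrier X" for s x
    using AX.l_closed[of "point_mass s" x] that by (simp add: act_def)
  have act_mult: "(s * t) \<bullet> x = s \<bullet> t \<bullet> x" if "x \<in> carrier X" for s t x
    using AX.l_mult[of "point_mass s" "point_mass t" x] that by (simp add: act_def conv_point_mass)
  have act_add: "s \<bullet> (x \<oplus>\<^bsub>X\<^esub> y) = s \<bullet> x \<oplus>\<^bsub>X\<^esub> s \<bullet> y" if "x \<in> carrier X" "y \<in> carrier X" for s x y
    using AX.l_add2[of "point_mass s" x y] that by (simp add: act_def)
  have act_smult: "s \<bullet> (z \<odot>\<^bsub>X\<^esub> x) = z \<odot>\<^bsub>X\<^esub> s \<bullet> x" if "x \<in> carrier X" for s x z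
    using AX.l_smult2[of "point_mass s" x z] that by (simp add: act_def)
  have d_mult: "d (s * t) = t \<bullet> d s \<oplus>\<^bsub>X\<^esub> s \<bullet> d t" for s t
  proof -
    have "d (s * t) = ract X (d s) (point_mass t) \<oplus>\<^bsub>X\<^esub> s \<bullet> d t"
      using D by (simp add: module_derivation_def d_def act_def conv_point_mass[symmetric])
    \<comment> \<open>Symmetry of \<open>X\<close> turns the right action in the Leibniz rule into a
      left one.\<close>
    then show ?thesis
      using X d_in[of s] by (simp add: symmetric_two_module_def act_def)
  qed
  have act_zero: "s \<bullet> \<zero>\<^bsub>X\<^esub> = \<zero>\<^bsub>X\<^esub>" for s
    using act_smult[of "\<zero>\<^bsub>X\<^esub>" s 0] by simp
  obtain L where L: "\<And>a x. \<lbrakk>a abs_summable_on UNIV; x \<in> carrier X\<rbrakk> \<Longrightarrow>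
      vnorm X (lact X a x) \<le> L * (\<Sum>\<^sub>\<infinity>s. cmod (a s)) * vnorm X x"
    using AX.l_bounded by auto
  obtain K where K: "\<And>a. a abs_summable_on UNIV \<Longrightarrow> vnorm X (D a) \<le> K * (\<Sum>\<^sub>\<infinity>s. cmod (a s))"
    using D by (auto simp: module_derivation_def)
  \<comment> \<open>Point masses have norm 1, so the bound is the same for all \<open>s\<close> and
    \<open>t\<close>; this uniformity is played off against linear growth below.\<close>
  have bound: "vnorm X (s \<bullet> d t) \<le> \<bar>L\<bar> * K" for s t
  proof -
    have "vnorm X (s \<bullet> d t) \<le> L * vnorm X (d t)"
      using L[of "point_mass s" "d t"] by (simp add: act_def)
    also have "\<dots> \<le> \<bar>L\<bar> * vnorm X (d t)"
      by (intro mult_right_mono) (auto simp: AX.X.vnorm_nonneg)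
    also have "\<dots> \<le> \<bar>L\<bar> * K"
      using K[of "point_mass t"] by (intro mult_left_mono) (auto simp: d_def)
    finally show ?thesis .
  qed
  \<comment> \<open>Stated for \<open>t * s * t = t\<close> so that it applies both to an idempotent
    paired with itself and to \<open>star s\<close> paired with \<open>s\<close>.\<close>
  have act_d_eq_0: "t \<bullet> d s = \<zero>\<^bsub>X\<^esub>" if t: "t * s * t = t" for s t
  proof -
    \<comment> \<open>A semigroup may lack an identity, so powers start at exponent 1:
      \<open>p k\<close> is the power of \<open>s\<close>, and \<open>q k\<close> that of
      \<open>t\<close>, with exponent \<open>k + 1\<close>.\<close>
    define p where "p k = (((*) s) ^^ k) s" for k
    define q where "q k = (((*) t) ^^ k) t" for k
    have qp: "q k * p k * t = t" for k
    proof (induction k)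
      case 0
      then show ?case using t by (simp add: p_def q_def)
    next
      case (Suc k)
      have "q (Suc k) * p (Suc k) * t = t * s * (q k * p k * t)"
        by (simp add: p_def q_def mult_ac)
      then show ?case using Suc t by simp
    qed
    \<comment> \<open>By the Leibniz rule for \<open>s * p k\<close>, the term with
      \<open>d s\<close> contributes one copy of \<open>t \<bullet> d s\<close> by
      \<open>qp\<close>. The term with \<open>d (p k)\<close> contributes \<open>k + 1\<close>
      copies by the induction hypothesis and \<open>t * s * t = t\<close>.\<close>
    have power: "q k \<bullet> d (p k) = complex_of_nat (Suc k) \<odot>\<^bsub>X\<^esub> t \<bullet> d s" for k
    proof (induction k)
      case 0
      then show ?case by (simp add: p_def q_def)
    next
      case (Suc k)
      have "q (Suc k) \<bullet> d (p (Suc k)) = (t * q k) \<bullet> (p k \<bullet> d s \<oplus>\<^bsub>X\<^esub> s \<bullet> d (p k))"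
        by (simp add: p_def q_def d_mult)
      also have "\<dots> = (t * q k * p k) \<bullet> d s \<oplus>\<^bsub>X\<^esub> (t * q k * s) \<bullet> d (p k)"
        by (simp add: act_add act_mult)
      also have "t * q k * p k = t" using qp[of k] by (simp add: mult_ac)
      also have "(t * q k * s) \<bullet> d (p k) = (t * s) \<bullet> q k \<bullet> d (p k)"
        by (simp add: act_mult[symmetric] mult_ac)
      also have "\<dots> = complex_of_nat (Suc k) \<odot>\<^bsub>X\<^esub> (t * s * t) \<bullet> d s"
        by (simp add: Suc act_smult act_mult)
      also have "t \<bullet> d s \<oplus>\<^bsub>X\<^esub> complex_of_nat (Suc k) \<odot>\<^bsub>X\<^esub> (t * s * t) \<bullet> d s =
          complex_of_nat (Suc (Suc k)) \<odot>\<^bsub>X\<^esub> t \<bullet> d s"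
        using AX.X.smult_add_left[of "t \<bullet> d s" 1 "complex_of_nat (Suc k)"] by (simp add: t)
      finally show ?case .
    qed
    \<comment> \<open>The multiples of one fixed norm stay bounded, so by the Archimedean property
      that norm is zero.\<close>
    have "real (Suc k) * vnorm X (t \<bullet> d s) \<le> \<bar>L\<bar> * K" for k
      using bound[of "q k" "p k"] unfolding power by (simp add: AX.X.vnorm_smult del: of_nat_Suc)
    then have le: "real k * vnorm X (t \<bullet> d s) \<le> \<bar>L\<bar> * K" for k
      using AX.X.vnorm_nonneg[of "t \<bullet> d s"] by (smt (verit) act_in d_in mult_right_mono of_nat_Suc)
    have "\<not> 0 < vnorm X (t \<bullet> d s)"
      using reals_Archimedean3[of "vnorm X (t \<bullet> d s)"] le by (meson not_le)
    then show ?thesis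
      using AX.X.vnorm_nonneg[of "t \<bullet> d s"] AX.X.vnorm_eq_0[of "t \<bullet> d s"] by simp
  qed
  define e where "e = s * star s"
  have e: "e * e = e"
    using mult_star_in_idempotents[of s] by (simp add: e_def idempotents_iff)
  have "e \<bullet> d e = \<zero>\<^bsub>X\<^esub>"
    by (rule act_d_eq_0) (simp add: e)
  \<comment> \<open>Since \<open>e * e = e\<close>, the Leibniz rule expresses \<open>d e\<close> as
    the sum of two copies of \<open>e \<bullet> d e\<close>.\<close>
  then have "d e = \<zero>\<^bsub>X\<^esub>"
    using d_mult[of e e] by (simp add: e)
  have "star s \<bullet> d s = \<zero>\<^bsub>X\<^esub>"
    by (rule act_d_eq_0) (rule star_inverse)
  then have "e \<bullet> d s = \<zero>\<^bsub>X\<^esub>"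
    by (simp add: e_def act_mult act_zero)
  \<comment> \<open>Expanding by the Leibniz rule gives \<open>s \<bullet> d e\<close> and
    \<open>e \<bullet> d s\<close>, both already known to vanish.\<close>
  have "d s = d (e * s)"
    by (simp add: e_def star_inverse)
  also have "\<dots> = \<zero>\<^bsub>X\<^esub>"
    using \<open>d e = \<zero>\<^bsub>X\<^esub>\<close> \<open>e \<bullet> d s = \<zero>\<^bsub>X\<^esub>\<close> by (simp add: d_mult act_zero)
  finally show ?thesis by (simp add: d_def)
qed

lemma module_derivation_eq_zero:
  fixes X :: "('s::{inverse_semigroup, ab_semigroup_mult} \<Rightarrow> complex, 's \<Rightarrow> complex, 'u) two_module"
  assumes X: "symmetric_two_module (ell1 idempotents) ell1_module X"
    and D: "module_derivation (ell1 idempotents) ell1_module X D"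
    and a: "a abs_summable_on UNIV"
  shows "D a = \<zero>\<^bsub>X\<^esub>"
proof -
  interpret commutative_banach_two_module "ell1 idempotents" ell1_module X
    using X by (simp add: symmetric_two_module_def)
  have D_in: "D a \<in> carrier X" if "a abs_summable_on UNIV" for a
    using D that by (simp add: module_derivation_def)
  have D_add: "D (\<lambda>s. a s + b s) = D a \<oplus>\<^bsub>X\<^esub> D b" if "a abs_summable_on UNIV" "b abs_summable_on UNIV" for a b
    using D that by (simp add: module_derivation_def)
  have D_lsc: "D (conv b \<alpha>) = lsc X \<alpha> (D b)"
    if "b abs_summable_on UNIV" "\<alpha> \<in> carrier (ell1 idempotents)" for b \<alpha>
    using D that by (simp add: module_derivation_def)
  obtain K where K: "K > 0" "\<And>a. a abs_summable_on UNIV \<Longrightarrow> vnorm X (D a) \<le> K * (\<Sum>\<^sub>\<infinity>s. cmod (a s))"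
    using D by (auto simp: module_derivation_def)
  have D_point: "D (\<lambda>t. z * point_mass s t) = \<zero>\<^bsub>X\<^esub>" for z s
  proof -
    \<comment> \<open>The derivation need not be complex linear, so the scalar \<open>z\<close> is
      carried by an element of the acting algebra: it is supported at the idempotent
      \<open>s * star s\<close>, and convolving it with the point mass at \<open>s\<close> gives
      \<open>z\<close> times that point mass.\<close>
    let ?\<alpha> = "\<lambda>t. z * point_mass (s * star s) t"
    have \<alpha>: "?\<alpha> \<in> carrier (ell1 idempotents)"
      using mult_star_in_idempotents[of s] abs_summable_on_smult[OF point_mass_abs_summable, of z "s * star s"]
      by (auto simp: point_mass_def)
    have "conv (point_mass s) ?\<alpha> = (\<lambda>t. z * point_mass (s * (s * star s)) t)"
      by (simp add: conv_smult_right conv_point_mass)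
    also have "s * (s * star s) = s"
      using star_inverse(1)[of s] by (simp add: mult_ac)
    finally have "D (\<lambda>t. z * point_mass s t) = lsc X ?\<alpha> (D (point_mass s))"
      using D_lsc[OF point_mass_abs_summable \<alpha>, of s] by simp
    also have "\<dots> = \<zero>\<^bsub>X\<^esub>"
      using CX.l_smult2[OF \<alpha>, of "\<zero>\<^bsub>X\<^esub>" 0] CX.l_closed[OF \<alpha>, of "\<zero>\<^bsub>X\<^esub>"]
      by (simp add: module_derivation_point_mass[OF X D])
    finally show ?thesis .
  qed
  \<comment> \<open>Truncations of \<open>a\<close>. Additivity kills those with finite support, and
    boundedness of \<open>D\<close> controls the remaining tail.\<close>
  define cut where "cut F = (\<lambda>s. if s \<in> F then a s else 0)" for F
  have cut: "cut F abs_summable_on UNIV" for F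
    by (rule Infinite_Sum.abs_summable_on_comparison_test'[OF a]) (simp add: cut_def)
  have D_cut: "D (cut F) = \<zero>\<^bsub>X\<^esub>" if "finite F" for F
    using that
  proof induction
    case empty
    \<comment> \<open>The empty truncation is the zero function, seen as \<open>0\<close> times a
      point mass.\<close>
    then show ?case
      using D_point[of 0] by (simp add: cut_def)
  next
    case (insert x F)
    have "cut (insert x F) = (\<lambda>s. a x * point_mass x s + cut F s)"
      using insert(2) by (auto simp: cut_def point_mass_def)
    then show ?case
      using D_add[OF abs_summable_on_smult[OF point_mass_abs_summable] cut, of "a x" x F] insert
      by (simp add: D_point)
  qed
  have small: "vnorm X (D a) \<le> \<epsilon>" if \<epsilon>: "\<epsilon> > 0" for \<epsilon>
  proof -
    have "0 < \<epsilon> / K" using \<epsilon> K by simp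
    then obtain F where F: "finite F" "dist (\<Sum>s\<in>F. cmod (a s)) (\<Sum>\<^sub>\<infinity>s. cmod (a s)) \<le> \<epsilon> / K"
      using infsum_finite_approximation[OF a] by blast
    \<comment> \<open>The norm is additive over disjoint supports, so the tail has norm equal to the
      defect of the finite partial sum.\<close>
    have "(\<Sum>\<^sub>\<infinity>s. cmod (a s)) = (\<Sum>\<^sub>\<infinity>s. cmod (cut F s) + cmod (cut (- F) s))"
      by (intro infsum_cong) (simp add: cut_def)
    also have "\<dots> = (\<Sum>\<^sub>\<infinity>s. cmod (cut F s)) + (\<Sum>\<^sub>\<infinity>s. cmod (cut (- F) s))"
      by (rule infsum_add[OF cut cut])
    also have "(\<Sum>\<^sub>\<infinity>s. cmod (cut F s)) = (\<Sum>\<^sub>\<infinity>s\<in>F. cmod (a s))"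
      by (rule infsum_cong_neutral) (auto simp: cut_def)
    finally have tail: "(\<Sum>\<^sub>\<infinity>s. cmod (cut (- F) s)) \<le> \<epsilon> / K"
      using F by (simp add: dist_real_def)
    have "D a = D (\<lambda>s. cut F s + cut (- F) s)"
      by (rule arg_cong[of _ _ D]) (auto simp: cut_def)
    also have "\<dots> = D (cut (- F))"
      using D_add[OF cut cut, of F "- F"] D_cut[OF F(1)] D_in[OF cut] by simp
    finally have "vnorm X (D a) \<le> K * (\<Sum>\<^sub>\<infinity>s. cmod (cut (- F) s))"
      using K(2)[OF cut] by simp
    also have "\<dots> \<le> K * (\<epsilon> / K)"
      using K(1) tail by (intro mult_left_mono) auto
    finally show ?thesis using K(1) by simp
  qed
  have "vnorm X (D a) \<le> 0"
    by (rule field_le_epsilon) (simp add: small)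
  then have "vnorm X (D a) = 0"
    using AX.X.vnorm_nonneg[OF D_in[OF a]] by simp
  then show ?thesis
    using AX.X.vnorm_eq_0[OF D_in[OF a]] by simp
qed

theorem theorem6p1:
  fixes n :: nat
  shows "n_weakly_module_amenable TYPE('u) n
    (ell1 (idempotents :: 's::{inverse_semigroup, ab_semigroup_mult} set))
    (ell1_module :: ('s \<Rightarrow> complex, 's \<Rightarrow> complex) module_alg)"
  unfolding n_weakly_module_amenable_def
proof (intro conjI allI impI)
  let ?\<A> = "ell1 (idempotents :: 's set)"
  let ?A = "ell1_module :: ('s \<Rightarrow> complex, 's \<Rightarrow> complex) module_alg"
  show "banach_module_algebra ?\<A> ?A"
    by (rule banach_module_algebra_ell1)
  fix X :: "('s \<Rightarrow> complex, 's \<Rightarrow> complex, 'u) two_module"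
  assume dual: "is_nth_dual ?\<A> ?A (quotient_module ?A (module_ideal ?\<A> ?A)) n X"
  \<comment> \<open>Both sides are the convolution of \<open>a\<close>, \<open>b\<close> and
    \<open>\<alpha>\<close> in some order, so the generators of \<open>J\<close> vanish.\<close>
  have eq: "scr ?A a \<alpha> \<otimes>\<^bsub>?A\<^esub> b = a \<otimes>\<^bsub>?A\<^esub> scl ?A \<alpha> b"
    if "a \<in> carrier ?A" "b \<in> carrier ?A" "\<alpha> \<in> carrier ?\<A>" for a b \<alpha>
    using that by (simp add: conv_assoc conv_commute conv_left_commute)
  have "module_ideal ?\<A> ?A = {\<lambda>s. 0}"
    using module_ideal_eq_zero[OF banach_module_algebra_ell1 eq] by simp
  \<comment> \<open>Symmetry is carried from \<open>ell1_two_module\<close> to the quotient along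
    \<open>x \<mapsto> {x}\<close>, and from there to the \<open>n\<close>-th dual.\<close>
  with dual have X: "symmetric_two_module ?\<A> ?A X"
    using symmetric_two_module_nth_dual[OF banach_module_algebra_ell1
        symmetric_two_module_isometric[OF banach_module_algebra_ell1 symmetric_two_module_ell1
          isometric_iso_ell1_quotient]] by simp
  then show "commutative_banach_two_module ?\<A> ?A X"
    by (simp add: symmetric_two_module_def)
  then interpret commutative_banach_two_module ?\<A> ?A X .
  fix D
  assume D: "module_derivation ?\<A> ?A X D"
  \<comment> \<open>As \<open>D\<close> vanishes, the zero vector implements it as an inner
    derivation.\<close>
  have "D a = lact X a \<zero>\<^bsub>X\<^esub> \<ominus>\<^bsub>X\<^esub> ract X \<zero>\<^bsub>X\<^esub> a" if a: "a \<in> carrier ?A" for a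
  proof -
    have "lact X a \<zero>\<^bsub>X\<^esub> = ract X \<zero>\<^bsub>X\<^esub> a"
      using X a by (simp add: symmetric_two_module_def)
    moreover have "ract X \<zero>\<^bsub>X\<^esub> a \<in> carrier X"
      by (rule AX.r_closed[OF a]) simp
    moreover have "D a = \<zero>\<^bsub>X\<^esub>"
      using module_derivation_eq_zero[OF X D] a by simp
    ultimately show ?thesis
      by (simp add: a_minus_def AX.X.r_neg)
  qed
  then show "inner_derivation ?A X D"
    unfolding inner_derivation_def by (intro bexI[of _ "\<zero>\<^bsub>X\<^esub>"]) auto
qed

end
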